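(* Let $\Omega\subset\mathbb{H}$ be a circular domain and let $f,g\in\mathcal{SEM}(\Omega)\setminus\mathcal{SEM}_{\mathbb{R}}(\Omega)$, neither of which is a zero divisor, be such that $\mathcal{S}_{f,g}:\mathcal{SEM}(\Omega)\to\mathcal{SEM}(\Omega)$, $\mathcal{S}_{f,g}(\chi)=f*\chi+\chi*g$, is an isomorphism. Set $$\lambda_{L}=2g_{0}+f+g^{s}f^{-*},\qquad \lambda_{R}=2f_{0}+g+f^{s}g^{-*}.$$ Then for any $\mathfrak{b}\in\mathcal{SEM}(\Omega)$ the unique solution of $\mathcal{S}_{f,g}(\chi)=\mathfrak{b}$ is $$\chi=\lambda_{L}^{-*}*(\mathfrak{b}+f^{-*}*\mathfrak{b}*g^{c})=(\mathfrak{b}+f^{c}*\mathfrak{b}*g^{-*})*\lambda_{R}^{-*}.$$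
   Context: $\mathbb{H}$ denotes the quaternions, $q^c$ the quaternionic conjugate, $\mathbb{S}=\{q\in\mathbb{H}: q^2=-1\}$, and $\mathbb{C}_I=\mathbb{R}+I\mathbb{R}$ for $I\in\mathbb{S}$. For $q=x+Iy$ put $\mathbb{S}_q=\{x+Jy: J\in\mathbb{S}\}$. A domain (connected open set) $\Omega\subset\mathbb{H}$ is circular if $\mathbb{S}_q\subset\Omega$ for all $q\in\Omega$. A function $f$ on a circular open set $\Omega$ is slice regular ($f\in\mathcal{SR}(\Omega)$) if $f(x+Iy)=F_1(x,y)+IF_2(x,y)$ for all $x+Iy\in\Omega$ ($x,y\in\mathbb{R}$, $I\in\mathbb{S}$), with $\mathbb{H}$-valued $F_1$ even in $y$ and $F_2$ odd in $y$, and each restriction $f|_{\Omega\cap\mathbb{C}_I}$ is real differentiable with $\frac12(\partial_x+I\partial_y)f|_{\Omega\cap\mathbb{C}_I}\equiv0$. The $*$-product is $(f*g)(q)=0$ if $f(q)=0$ and $(f*g)(q)=f(q)\,g(f(q)^{-1}qf(q))$ otherwise. $f$ is slice preserving if $f(\Omega\cap\mathbb{C}_I)\subset\mathbb{C}_I$ for every $I\in\mathbb{S}$. A function $f$ is slice semi-regular on $\Omega$ ($f\in\mathcal{SEM}(\Omega)$) if there is a circular open $\widetilde\Omega\subseteq\Omega$ with $f\in\mathcal{SR}(\widetilde\Omega)$ and each point of $\Omega\setminus\widetilde\Omega$ is a pole or a removable singularity; i.e. $\Omega\setminus\widetilde\Omega$ consists of isolated real points and isolated spheres $\mathbb{S}_p$,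 near each of which $\Delta_p^m f$ extends slice regularly for some integer $m\ge0$, where $\Delta_p(q)=q^2-2\mathrm{Re}(p)q+|p|^2$. Functions agreeing where both are defined are identified. $\mathcal{SEM}_{\mathbb{R}}(\Omega)$ is the subset of slice preserving elements; it is a field and the center of the algebra $(\mathcal{SEM}(\Omega),+,* )$, which is a 4-dimensional vector space over it: for an orthonormal basis $(1,I,J,K)$ of $\mathbb{H}$, each $f$ is uniquely $f_0+f_1I+f_2J+f_3K$ with $f_\ell\in\mathcal{SEM}_{\mathbb{R}}(\Omega)$. Set $f^c=f_0-(f_1I+f_2J+f_3K)$, $f^s=f*f^c=f_0^2+f_1^2+f_2^2+f_3^2$, $f_0=(f+f^c)/2$. $f$ is $*$-invertible iff $f^s\not\equiv0$, with $f^{-*}=(f^s)^{-1}f^c$. A zero divisor is $f\not\equiv0$ with $f^s\equiv0$. Isomorphism means isomorphism of $\mathcal{SEM}_{\mathbb{R}}(\Omega)$-vector spaces. *)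

theory Defs
  imports "HOL-Analysis.Analysis" "HOL-Algebra.Ring"
begin

section \<open>Quaternions\<close>

datatype quat = Quat (qre: real) (qim1: real) (qim2: real) (qim3: real)

lemma quat_eq_iff: "p = q \<longleftrightarrow> qre p = qre q \<and> qim1 p = qim1 q \<and> qim2 p = qim2 q \<and> qim3 p = qim3 q"
  by (cases p; cases q) auto

instantiation quat :: ring_1
begin

definition "0 = Quat 0 0 0 0"
definition "1 = Quat 1 0 0 0"
definition "p + q = Quat (qre p + qre q) (qim1 p + qim1 q) (qim2 p + qim2 q) (qim3 p + qim3 q)"
definition "- p = Quat (- qre p) (- qim1 p) (- qim2 p) (- qim3 p)"
definition "(p::quat) - q = Quat (qre p - qre q) (qim1 p - qim1 q) (qim2 p - qim2 q) (qim3 p - qim3 q)"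
definition "p * q = Quat
  (qre p * qre q - qim1 p * qim1 q - qim2 p * qim2 q - qim3 p * qim3 q)
  (qre p * qim1 q + qim1 p * qre q + qim2 p * qim3 q - qim3 p * qim2 q)
  (qre p * qim2 q - qim1 p * qim3 q + qim2 p * qre q + qim3 p * qim1 q)
  (qre p * qim3 q + qim1 p * qim2 q - qim2 p * qim1 q + qim3 p * qre q)"

instance
  by standard
    (simp_all add: zero_quat_def one_quat_def plus_quat_def uminus_quat_def minus_quat_def
      times_quat_def algebra_simps)

end

lemma quat_sel_simps [simp]:
  "qre 0 = 0" "qim1 0 = 0" "qim2 0 = 0" "qim3 0 = 0"
  "qre 1 = 1" "qim1 1 = 0" "qim2 1 = 0" "qim3 1 = 0"
  "qre (p + q) = qre p + qre q" "qim1 (p + q) = qim1 p + qim1 q"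
  "qim2 (p + q) = qim2 p + qim2 q" "qim3 (p + q) = qim3 p + qim3 q"
  "qre (- p) = - qre p" "qim1 (- p) = - qim1 p" "qim2 (- p) = - qim2 p" "qim3 (- p) = - qim3 p"
  "qre (p - q) = qre p - qre q" "qim1 (p - q) = qim1 p - qim1 q"
  "qim2 (p - q) = qim2 p - qim2 q" "qim3 (p - q) = qim3 p - qim3 q"
  "qre (p * q) = qre p * qre q - qim1 p * qim1 q - qim2 p * qim2 q - qim3 p * qim3 q"
  "qim1 (p * q) = qre p * qim1 q + qim1 p * qre q + qim2 p * qim3 q - qim3 p * qim2 q"
  "qim2 (p * q) = qre p * qim2 q - qim1 p * qim3 q + qim2 p * qre q + qim3 p * qim1 q"
  "qim3 (p * q) = qre p * qim3 q + qim1 p * qim2 q - qim2 p * qim1 q + qim3 p * qre q"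
  by (simp_all add: zero_quat_def one_quat_def plus_quat_def uminus_quat_def minus_quat_def
      times_quat_def)

instantiation quat :: real_algebra_1
begin

definition "r *\<^sub>R p = Quat (r * qre p) (r * qim1 p) (r * qim2 p) (r * qim3 p)"

instance
  by standard (simp_all add: quat_eq_iff scaleR_quat_def algebra_simps)

end

lemma quat_scaleR_sel [simp]:
  "qre (r *\<^sub>R p) = r * qre p" "qim1 (r *\<^sub>R p) = r * qim1 p"
  "qim2 (r *\<^sub>R p) = r * qim2 p" "qim3 (r *\<^sub>R p) = r * qim3 p"
  by (simp_all add: scaleR_quat_def)

lemma quat_of_real_sel [simp]:
  "qre (of_real r) = r" "qim1 (of_real r) = 0" "qim2 (of_real r) = 0" "qim3 (of_real r) = 0"
  by (simp_all add: of_real_def)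

lemma quat_sq_eq_0_iff:
  "(qre p)\<^sup>2 + (qim1 p)\<^sup>2 + (qim2 p)\<^sup>2 + (qim3 p)\<^sup>2 = 0 \<longleftrightarrow> p = 0"
  by (simp add: quat_eq_iff add_nonneg_eq_0_iff)

instantiation quat :: real_div_algebra
begin

definition "inverse p = (1 / ((qre p)\<^sup>2 + (qim1 p)\<^sup>2 + (qim2 p)\<^sup>2 + (qim3 p)\<^sup>2)) *\<^sub>R
  Quat (qre p) (- qim1 p) (- qim2 p) (- qim3 p)"
definition "(p::quat) div q = p * inverse q"

instance
proof
  fix p q :: quat
  let ?n = "(qre p)\<^sup>2 + (qim1 p)\<^sup>2 + (qim2 p)\<^sup>2 + (qim3 p)\<^sup>2"
  let ?c = "Quat (qre p) (- qim1 p) (- qim2 p) (- qim3 p)"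
  have l: "?c * p = of_real ?n" and r: "p * ?c = of_real ?n"
    by (simp_all add: quat_eq_iff power2_eq_square algebra_simps)
  show "inverse p * p = 1" "p * inverse p = 1" if "p \<noteq> 0"
    using that quat_sq_eq_0_iff[of p] l r
    by (simp_all add: inverse_quat_def scaleR_conv_of_real[of _ "of_real _"] del: of_real_add of_real_power
        flip: of_real_mult)
  show "p div q = p * inverse q"
    by (rule divide_quat_def)
  show "inverse (0::quat) = 0"
    by (simp add: inverse_quat_def)
qed

end

instantiation quat :: real_inner
begin

definition "inner p q = qre p * qre q + qim1 p * qim1 q + qim2 p * qim2 q + qim3 p * qim3 q"
definition "norm p = sqrt ((qre p)\<^sup>2 + (qim1 p)\<^sup>2 + (qim2 p)\<^sup>2 + (qim3 p)\<^sup>2)"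
definition "sgn (p::quat) = p /\<^sub>R norm p"
definition "dist (p::quat) q = norm (p - q)"
definition [code del]:
  "uniformity = (INF e\<in>{0<..}. principal {(p::quat, q). dist p q < e})"
definition [code del]:
  "open (U::quat set) \<longleftrightarrow> (\<forall>p\<in>U. eventually (\<lambda>(p', q). p' = p \<longrightarrow> q \<in> U) uniformity)"

instance
proof
  fix p q r :: quat and a :: real
  show "norm p = sqrt (inner p p)"
    by (simp add: norm_quat_def inner_quat_def power2_eq_square)
  show "(inner p p = 0) = (p = 0)"
    using quat_sq_eq_0_iff[of p] by (simp add: inner_quat_def power2_eq_square)
  show "inner p q = inner q p" "inner (p + q) r = inner p r + inner q r"
    "inner (a *\<^sub>R p) q = a * inner p q" "0 \<le> inner p p"
    by (simp_all add: inner_quat_def algebra_simps)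
qed (simp_all add: sgn_quat_def dist_quat_def uniformity_quat_def open_quat_def)

end

instance quat :: real_normed_div_algebra
proof
  fix p q :: quat
  show "norm (p * q) = norm p * norm q"
    unfolding norm_quat_def real_sqrt_mult[symmetric]
    by (rule arg_cong[of _ _ sqrt]) (simp add: power2_eq_square algebra_simps)
qed

definition quat_i :: quat where "quat_i = Quat 0 1 0 0"
definition quat_j :: quat where "quat_j = Quat 0 0 1 0"
definition quat_k :: quat where "quat_k = Quat 0 0 0 1"

definition imag_units :: "quat set"
  where "imag_units = {q. q\<^sup>2 = -1}"

definition slice_plane :: "quat \<Rightarrow> quat set"
  where "slice_plane I = {of_real x + I * of_real y | x y. True}"

(* For real q this is the singleton {q}. *)
definition qsphere :: "quat \<Rightarrow> quat set"
  where "qsphere q = {of_real x + J * of_real y | x y J.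
    J \<in> imag_units \<and> (\<exists>I\<in>imag_units. q = of_real x + I * of_real y)}"

definition circular :: "quat set \<Rightarrow> bool"
  where "circular \<Omega> \<longleftrightarrow> (\<forall>q\<in>\<Omega>. qsphere q \<subseteq> \<Omega>)"

definition circular_domain :: "quat set \<Rightarrow> bool"
  where "circular_domain \<Omega> \<longleftrightarrow> open \<Omega> \<and> connected \<Omega> \<and> circular \<Omega>"


section \<open>Slice regular functions\<close>

(* F1 and F2 are total; only their values at points (x, y) with x + I y in the domain matter.
   Such points form a set symmetric under y -> -y, so any even/odd pair given there extends by 0. *)
definition slice_function_on :: "(quat \<Rightarrow> quat) \<Rightarrow> quat set \<Rightarrow> bool"
  where "slice_function_on f \<Omega> \<longleftrightarrow> (\<exists>F1 F2 :: real \<Rightarrow> real \<Rightarrow> quat.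
    (\<forall>x y. F1 x (- y) = F1 x y) \<and> (\<forall>x y. F2 x (- y) = - F2 x y) \<and>
    (\<forall>x y. \<forall>I\<in>imag_units. of_real x + I * of_real y \<in> \<Omega> \<longrightarrow>
      f (of_real x + I * of_real y) = F1 x y + I * F2 x y))"

(* D (1, 0) and D (0, 1) are the partial derivatives in x and y of the restriction to a slice. *)
definition slice_regular_on :: "(quat \<Rightarrow> quat) \<Rightarrow> quat set \<Rightarrow> bool"
  where "slice_regular_on f \<Omega> \<longleftrightarrow> slice_function_on f \<Omega> \<and>
    (\<forall>I\<in>imag_units. \<forall>x y. of_real x + I * of_real y \<in> \<Omega> \<longrightarrow>
      (\<exists>D. ((\<lambda>(s, t). f (of_real s + I * of_real t)) has_derivative D) (at (x, y)) \<and>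
        (1/2) *\<^sub>R (D (1, 0) + I * D (0, 1)) = 0))"

definition star_fun :: "(quat \<Rightarrow> quat) \<Rightarrow> (quat \<Rightarrow> quat) \<Rightarrow> quat \<Rightarrow> quat"
  where "star_fun f g q = (if f q = 0 then 0 else f q * g (inverse (f q) * q * f q))"

definition slice_preserving_on :: "(quat \<Rightarrow> quat) \<Rightarrow> quat set \<Rightarrow> bool"
  where "slice_preserving_on f \<Omega> \<longleftrightarrow>
    (\<forall>I\<in>imag_units. f ` (\<Omega> \<inter> slice_plane I) \<subseteq> slice_plane I)"

definition sphere_poly :: "quat \<Rightarrow> quat \<Rightarrow> quat"
  where "sphere_poly p q = q\<^sup>2 - of_real (2 * qre p) * q + of_real ((norm p)\<^sup>2)"


section \<open>Slice semi-regular functions\<close>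

(* A pair (A, f) is a function f with domain A; the values of f outside A are irrelevant.
   Since U - qsphere p is contained in A, the sphere (or real point) of p is isolated in
   \<Omega> - A. The polynomial sphere_poly p is slice preserving, so its *-product with f is the
   pointwise product. *)
definition semiregular_reps :: "quat set \<Rightarrow> (quat set \<times> (quat \<Rightarrow> quat)) set"
  where "semiregular_reps \<Omega> = {(A, f). A \<subseteq> \<Omega> \<and> open A \<and> circular A \<and> slice_regular_on f A \<and>
    (\<forall>p\<in>\<Omega> - A. \<exists>U h. \<exists>m::nat. open U \<and> circular U \<and> p \<in> U \<and> U \<subseteq> \<Omega> \<and> U - qsphere p \<subseteq> A \<and>
      slice_regular_on h U \<and> (\<forall>q\<in>U - qsphere p. h q = sphere_poly p q ^ m * f q))}"

definition sem_rel :: "quat set \<Rightarrow> ((quat set \<times> (quat \<Rightarrow> quat)) \<times> (quat set \<times> (quat \<Rightarrow> quat))) set"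
  where "sem_rel \<Omega> = {((A, f), (B, g)).
    (A, f) \<in> semiregular_reps \<Omega> \<and> (B, g) \<in> semiregular_reps \<Omega> \<and> (\<forall>q\<in>A \<inter> B. f q = g q)}"

type_synonym semireg = "(quat set \<times> (quat \<Rightarrow> quat)) set"

definition sem_const :: "quat set \<Rightarrow> quat \<Rightarrow> semireg"
  where "sem_const \<Omega> c = sem_rel \<Omega> `` {(\<Omega>, \<lambda>_. c)}"

definition sem_add :: "quat set \<Rightarrow> semireg \<Rightarrow> semireg \<Rightarrow> semireg"
  where "sem_add \<Omega> X Y = (\<Union>(A, f)\<in>X. \<Union>(B, g)\<in>Y. sem_rel \<Omega> `` {(A \<inter> B, \<lambda>q. f q + g q)})"

definition sem_star :: "quat set \<Rightarrow> semireg \<Rightarrow> semireg \<Rightarrow> semireg"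
  where "sem_star \<Omega> X Y = (\<Union>(A, f)\<in>X. \<Union>(B, g)\<in>Y. sem_rel \<Omega> `` {(A \<inter> B, star_fun f g)})"

definition SEM :: "quat set \<Rightarrow> semireg ring"
  where "SEM \<Omega> = \<lparr>carrier = semiregular_reps \<Omega> // sem_rel \<Omega>, mult = sem_star \<Omega>,
    one = sem_const \<Omega> 1, zero = sem_const \<Omega> 0, add = sem_add \<Omega>\<rparr>"

definition SEM_R :: "quat set \<Rightarrow> semireg set"
  where "SEM_R \<Omega> = {X \<in> carrier (SEM \<Omega>). \<exists>(A, f)\<in>X. slice_preserving_on f A}"

(* Coordinates with respect to the orthonormal basis (1, i, j, k). The real part and the
   conjugate below do not depend on which orthonormal basis (1, I, J, K) is used. *)
definition sem_coords :: "quat set \<Rightarrow> semireg \<Rightarrow> semireg \<times> semireg \<times> semireg \<times> semireg"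
  where "sem_coords \<Omega> f = (THE (f0, f1, f2, f3).
    f0 \<in> SEM_R \<Omega> \<and> f1 \<in> SEM_R \<Omega> \<and> f2 \<in> SEM_R \<Omega> \<and> f3 \<in> SEM_R \<Omega> \<and>
    f = f0 \<oplus>\<^bsub>SEM \<Omega>\<^esub> (f1 \<otimes>\<^bsub>SEM \<Omega>\<^esub> sem_const \<Omega> quat_i \<oplus>\<^bsub>SEM \<Omega>\<^esub> f2 \<otimes>\<^bsub>SEM \<Omega>\<^esub> sem_const \<Omega> quat_j
      \<oplus>\<^bsub>SEM \<Omega>\<^esub> f3 \<otimes>\<^bsub>SEM \<Omega>\<^esub> sem_const \<Omega> quat_k))"

definition sem_re :: "quat set \<Rightarrow> semireg \<Rightarrow> semireg"
  where "sem_re \<Omega> f = (case sem_coords \<Omega> f of (f0, f1, f2, f3) \<Rightarrow> f0)"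

definition sem_conj :: "quat set \<Rightarrow> semireg \<Rightarrow> semireg"
  where "sem_conj \<Omega> f = (case sem_coords \<Omega> f of (f0, f1, f2, f3) \<Rightarrow>
    f0 \<ominus>\<^bsub>SEM \<Omega>\<^esub> (f1 \<otimes>\<^bsub>SEM \<Omega>\<^esub> sem_const \<Omega> quat_i \<oplus>\<^bsub>SEM \<Omega>\<^esub> f2 \<otimes>\<^bsub>SEM \<Omega>\<^esub> sem_const \<Omega> quat_j
      \<oplus>\<^bsub>SEM \<Omega>\<^esub> f3 \<otimes>\<^bsub>SEM \<Omega>\<^esub> sem_const \<Omega> quat_k))"

definition sem_symm :: "quat set \<Rightarrow> semireg \<Rightarrow> semireg"
  where "sem_symm \<Omega> f = f \<otimes>\<^bsub>SEM \<Omega>\<^esub> sem_conj \<Omega> f"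

definition sem_inv :: "quat set \<Rightarrow> semireg \<Rightarrow> semireg"
  where "sem_inv \<Omega> f = inv\<^bsub>SEM \<Omega>\<^esub> (sem_symm \<Omega> f) \<otimes>\<^bsub>SEM \<Omega>\<^esub> sem_conj \<Omega> f"

definition sem_zero_divisor :: "quat set \<Rightarrow> semireg \<Rightarrow> bool"
  where "sem_zero_divisor \<Omega> f \<longleftrightarrow> f \<in> carrier (SEM \<Omega>) \<and> f \<noteq> \<zero>\<^bsub>SEM \<Omega>\<^esub> \<and> sem_symm \<Omega> f = \<zero>\<^bsub>SEM \<Omega>\<^esub>"

definition SEM_R_isomorphism :: "quat set \<Rightarrow> (semireg \<Rightarrow> semireg) \<Rightarrow> bool"
  where "SEM_R_isomorphism \<Omega> T \<longleftrightarrow>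
    bij_betw T (carrier (SEM \<Omega>)) (carrier (SEM \<Omega>)) \<and>
    (\<forall>x\<in>carrier (SEM \<Omega>). \<forall>y\<in>carrier (SEM \<Omega>). T (x \<oplus>\<^bsub>SEM \<Omega>\<^esub> y) = T x \<oplus>\<^bsub>SEM \<Omega>\<^esub> T y) \<and>
    (\<forall>a\<in>SEM_R \<Omega>. \<forall>x\<in>carrier (SEM \<Omega>). T (a \<otimes>\<^bsub>SEM \<Omega>\<^esub> x) = a \<otimes>\<^bsub>SEM \<Omega>\<^esub> T x)"

definition sylvester :: "quat set \<Rightarrow> semireg \<Rightarrow> semireg \<Rightarrow> semireg \<Rightarrow> semireg"
  where "sylvester \<Omega> f g x = f \<otimes>\<^bsub>SEM \<Omega>\<^esub> x \<oplus>\<^bsub>SEM \<Omega>\<^esub> x \<otimes>\<^bsub>SEM \<Omega>\<^esub> g"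

end

theory Submission
  imports Defs "HOL-Complex_Analysis.Meromorphic"
begin

text \<open>
  A slice regular function \<open>f\<close> is determined by its stem \<open>F = F1 + \<iota> F2\<close>, where
  \<open>f (x + I y) = F1 x y + I F2 x y\<close> and \<open>\<iota>\<close> is a complex unit that commutes with the quaternions. The
  stem takes values in the biquaternions, the quaternions with complex coefficients, and it
  translates everything in the theorem into ordinary complex analysis. Slice regularity of \<open>f\<close>
  means that the four complex coordinates of \<open>F\<close> are holomorphic (\<open>slice_regular_on_iff\<close>),
  semi-regularity means that they are meromorphic (\<open>semiregular_reps_iff\<close>), and the star product of
  functions is the pointwise product of stems (\<open>stem_star_fun\<close>). So the semi-regular functions
  are the meromorphic biquaternion-valued functions \<open>F\<close> with \<open>F (cnj z) = bq_cnj (F z)\<close>, taken modulo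
  equality off a sparse set, and the slice preserving ones are those with scalar stem. An identity
  between semi-regular functions is then checked pointwise, off a sparse set. A class is invertible
  as soon as its norm is not identically zero, because a symmetric meromorphic scalar function on a
  circular domain vanishes identically or only on a sparse set
  (\<open>symmetric_meromorphic_zero_or_nonzero\<close>).

  If \<open>b = f x + x g\<close>, then \<open>b + f\<^sup>-\<^sup>1 b g\<^sup>c = \<lambda> x\<close> with
  \<open>\<lambda> = 2 g\<^sub>0 + f + g\<^sup>s f\<^sup>-\<^sup>1\<close>, because \<open>g + g\<^sup>c = 2 g\<^sub>0\<close> and \<open>g g\<^sup>c = g\<^sup>s\<close> are central
  (\<open>bq_sylvester_left\<close>). The substance is that \<open>\<lambda>\<close> is invertible, which uses that the Sylvester
  operator is injective and that \<open>g\<close> is not central. The product \<open>\<lambda> f = f\<^sup>2 + 2 g\<^sub>0 f + g\<^sup>s\<close> is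
  the characteristic polynomial of \<open>- g\<close> evaluated at \<open>f\<close>, and the operator sends \<open>f e + e g\<^sup>c\<close> to
  \<open>(\<lambda> f) e\<close> (\<open>bq_cayley_hamilton_left\<close>). If \<open>\<lambda>\<close> were not invertible, some \<open>e \<noteq> 0\<close> would satisfy
  \<open>(\<lambda> f) e = 0\<close>. The same holds for every multiple \<open>e r\<close>, so injectivity gives
  \<open>f (e r) = - (e r) g\<^sup>c\<close> for all \<open>r\<close>. Comparing this for \<open>r\<close> and for \<open>r q\<close> shows that \<open>e r\<close>
  annihilates every commutator of \<open>g\<^sup>c\<close> with \<open>q\<close>; the commutators of a non-central element generate
  the unit ideal, and therefore \<open>e = 0\<close> (\<open>bq_twisted_linear_right_imp_zero\<close>). The formula with
  \<open>\<lambda>\<^sub>R\<close> is the mirror image.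
\<close>

section \<open>Biquaternions\<close>

text \<open>
  The quaternions with complex coefficients. The four complex coordinates are primitive, rather than
  a pair of quaternions, because holomorphy and meromorphy are conditions on them.
\<close>

datatype biquat = Biquat (bq0: complex) (bq1: complex) (bq2: complex) (bq3: complex)

lemma biquat_eq_iff:
  "a = b \<longleftrightarrow> bq0 a = bq0 b \<and> bq1 a = bq1 b \<and> bq2 a = bq2 b \<and> bq3 a = bq3 b"
  by (cases a; cases b) auto

instantiation biquat :: ring_1
begin

definition "0 = Biquat 0 0 0 0"
definition "1 = Biquat 1 0 0 0"
definition "a + b = Biquat (bq0 a + bq0 b) (bq1 a + bq1 b) (bq2 a + bq2 b) (bq3 a + bq3 b)"
definition "- a = Biquat (- bq0 a) (- bq1 a) (- bq2 a) (- bq3 a)"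
definition "(a::biquat) - b = Biquat (bq0 a - bq0 b) (bq1 a - bq1 b) (bq2 a - bq2 b) (bq3 a - bq3 b)"
definition "a * b = Biquat
  (bq0 a * bq0 b - bq1 a * bq1 b - bq2 a * bq2 b - bq3 a * bq3 b)
  (bq0 a * bq1 b + bq1 a * bq0 b + bq2 a * bq3 b - bq3 a * bq2 b)
  (bq0 a * bq2 b - bq1 a * bq3 b + bq2 a * bq0 b + bq3 a * bq1 b)
  (bq0 a * bq3 b + bq1 a * bq2 b - bq2 a * bq1 b + bq3 a * bq0 b)"

instance
  by standard
    (simp_all add: zero_biquat_def one_biquat_def plus_biquat_def uminus_biquat_def
      minus_biquat_def times_biquat_def algebra_simps)

end

lemma biquat_sel_simps [simp]:
  "bq0 0 = 0" "bq1 0 = 0" "bq2 0 = 0" "bq3 0 = 0"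
  "bq0 1 = 1" "bq1 1 = 0" "bq2 1 = 0" "bq3 1 = 0"
  "bq0 (a + b) = bq0 a + bq0 b" "bq1 (a + b) = bq1 a + bq1 b"
  "bq2 (a + b) = bq2 a + bq2 b" "bq3 (a + b) = bq3 a + bq3 b"
  "bq0 (- a) = - bq0 a" "bq1 (- a) = - bq1 a" "bq2 (- a) = - bq2 a" "bq3 (- a) = - bq3 a"
  "bq0 (a - b) = bq0 a - bq0 b" "bq1 (a - b) = bq1 a - bq1 b"
  "bq2 (a - b) = bq2 a - bq2 b" "bq3 (a - b) = bq3 a - bq3 b"
  "bq0 (a * b) = bq0 a * bq0 b - bq1 a * bq1 b - bq2 a * bq2 b - bq3 a * bq3 b"
  "bq1 (a * b) = bq0 a * bq1 b + bq1 a * bq0 b + bq2 a * bq3 b - bq3 a * bq2 b"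
  "bq2 (a * b) = bq0 a * bq2 b - bq1 a * bq3 b + bq2 a * bq0 b + bq3 a * bq1 b"
  "bq3 (a * b) = bq0 a * bq3 b + bq1 a * bq2 b - bq2 a * bq1 b + bq3 a * bq0 b"
  by (simp_all add: zero_biquat_def one_biquat_def plus_biquat_def uminus_biquat_def
      minus_biquat_def times_biquat_def)

definition bq_scalar :: "complex \<Rightarrow> biquat"
  where "bq_scalar c = Biquat c 0 0 0"

definition bq_conj :: "biquat \<Rightarrow> biquat"
  where "bq_conj a = Biquat (bq0 a) (- bq1 a) (- bq2 a) (- bq3 a)"

definition bq_norm :: "biquat \<Rightarrow> complex"
  where "bq_norm a = (bq0 a)\<^sup>2 + (bq1 a)\<^sup>2 + (bq2 a)\<^sup>2 + (bq3 a)\<^sup>2"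

definition bq_inv :: "biquat \<Rightarrow> biquat"
  where "bq_inv a = bq_scalar (1 / bq_norm a) * bq_conj a"

text \<open>
  Complex conjugation of the coefficients. It is multiplicative and unrelated to the quaternionic
  conjugation \<open>bq_conj\<close>, which reverses products.
\<close>

definition bq_cnj :: "biquat \<Rightarrow> biquat"
  where "bq_cnj a = Biquat (cnj (bq0 a)) (cnj (bq1 a)) (cnj (bq2 a)) (cnj (bq3 a))"

text \<open>
  The biquaternion \<open>p + \<iota> q\<close>, where \<open>\<iota>\<close> is the complex unit of the coefficients.
\<close>

definition bq_pair :: "quat \<Rightarrow> quat \<Rightarrow> biquat"
  where "bq_pair p q = Biquat (Complex (qre p) (qre q)) (Complex (qim1 p) (qim1 q))
    (Complex (qim2 p) (qim2 q)) (Complex (qim3 p) (qim3 q))"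

definition bq_Re :: "biquat \<Rightarrow> quat"
  where "bq_Re a = Quat (Re (bq0 a)) (Re (bq1 a)) (Re (bq2 a)) (Re (bq3 a))"

definition bq_Im :: "biquat \<Rightarrow> quat"
  where "bq_Im a = Quat (Im (bq0 a)) (Im (bq1 a)) (Im (bq2 a)) (Im (bq3 a))"

lemma bq_sel [simp]:
  "bq0 (bq_scalar c) = c" "bq1 (bq_scalar c) = 0" "bq2 (bq_scalar c) = 0" "bq3 (bq_scalar c) = 0"
  "bq0 (bq_conj a) = bq0 a" "bq1 (bq_conj a) = - bq1 a" "bq2 (bq_conj a) = - bq2 a"
  "bq3 (bq_conj a) = - bq3 a"
  "bq0 (bq_cnj a) = cnj (bq0 a)" "bq1 (bq_cnj a) = cnj (bq1 a)" "bq2 (bq_cnj a) = cnj (bq2 a)"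
  "bq3 (bq_cnj a) = cnj (bq3 a)"
  "bq0 (bq_pair p q) = Complex (qre p) (qre q)" "bq1 (bq_pair p q) = Complex (qim1 p) (qim1 q)"
  "bq2 (bq_pair p q) = Complex (qim2 p) (qim2 q)" "bq3 (bq_pair p q) = Complex (qim3 p) (qim3 q)"
  "qre (bq_Re a) = Re (bq0 a)" "qim1 (bq_Re a) = Re (bq1 a)" "qim2 (bq_Re a) = Re (bq2 a)"
  "qim3 (bq_Re a) = Re (bq3 a)"
  "qre (bq_Im a) = Im (bq0 a)" "qim1 (bq_Im a) = Im (bq1 a)" "qim2 (bq_Im a) = Im (bq2 a)"
  "qim3 (bq_Im a) = Im (bq3 a)"
  by (simp_all add: bq_scalar_def bq_conj_def bq_cnj_def bq_pair_def bq_Re_def bq_Im_def)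

lemma bq_pair_Re_Im [simp]: "bq_pair (bq_Re a) (bq_Im a) = a"
  by (simp add: biquat_eq_iff)

lemma bq_Re_pair [simp]: "bq_Re (bq_pair p q) = p"
  and bq_Im_pair [simp]: "bq_Im (bq_pair p q) = q"
  by (simp_all add: quat_eq_iff)

lemma bq_Re_Im_add [simp]:
  "bq_Re (a + b) = bq_Re a + bq_Re b" "bq_Im (a + b) = bq_Im a + bq_Im b"
  by (simp_all add: quat_eq_iff)

lemma bq_Re_Im_mult:
  "bq_Re (a * b) = bq_Re a * bq_Re b - bq_Im a * bq_Im b"
  "bq_Im (a * b) = bq_Re a * bq_Im b + bq_Im a * bq_Re b"
  by (simp_all add: quat_eq_iff)

lemma bq_Re_Im_cnj [simp]: "bq_Re (bq_cnj a) = bq_Re a" "bq_Im (bq_cnj a) = - bq_Im a"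
  by (simp_all add: quat_eq_iff)

lemma bq_cnj_simps [simp]:
  "bq_cnj 0 = 0" "bq_cnj 1 = 1" "bq_cnj (a + b) = bq_cnj a + bq_cnj b"
  "bq_cnj (a - b) = bq_cnj a - bq_cnj b" "bq_cnj (- a) = - bq_cnj a"
  "bq_cnj (a * b) = bq_cnj a * bq_cnj b" "bq_cnj (bq_scalar c) = bq_scalar (cnj c)"
  "bq_cnj (bq_conj a) = bq_conj (bq_cnj a)" "bq_cnj (bq_pair p 0) = bq_pair p 0"
  "bq_norm (bq_cnj a) = cnj (bq_norm a)"
  by (simp_all add: biquat_eq_iff bq_norm_def complex_eq_iff)

lemma bq_scalar_central: "bq_scalar c * a = a * bq_scalar c"
  by (simp add: biquat_eq_iff)

lemma bq_scalar_simps [simp]: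
  "bq_scalar 0 = 0" "bq_scalar 1 = 1"
  "bq_scalar c * bq_scalar d = bq_scalar (c * d)" "bq_scalar c + bq_scalar d = bq_scalar (c + d)"
  by (simp_all add: biquat_eq_iff)

lemma bq_mult_conj: "a * bq_conj a = bq_scalar (bq_norm a)"
  and bq_conj_mult_self: "bq_conj a * a = bq_scalar (bq_norm a)"
  by (simp_all add: biquat_eq_iff bq_norm_def power2_eq_square)

lemma bq_add_conj: "a + bq_conj a = bq_scalar (2 * bq0 a)"
  by (simp add: biquat_eq_iff)

lemma bq_norm_mult: "bq_norm (a * b) = bq_norm a * bq_norm b"
  by (simp add: bq_norm_def power2_eq_square algebra_simps)

lemma bq_norm_simps [simp]: "bq_norm 1 = 1" "bq_norm (bq_conj a) = bq_norm a"
  by (simp_all add: bq_norm_def)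

lemma bq_mult_inv:
  assumes "bq_norm a \<noteq> 0"
  shows "a * bq_inv a = 1" "bq_inv a * a = 1"
proof -
  have "a * bq_inv a = bq_scalar (1 / bq_norm a) * (a * bq_conj a)"
    unfolding bq_inv_def by (simp add: bq_scalar_central[symmetric] mult.assoc[symmetric])
  then show "a * bq_inv a = 1"
    using assms by (simp add: bq_mult_conj)
  have "bq_inv a * a = bq_scalar (1 / bq_norm a) * (bq_conj a * a)"
    unfolding bq_inv_def by (simp add: mult.assoc)
  then show "bq_inv a * a = 1"
    using assms by (simp add: bq_conj_mult_self)
qed

definition bq_i :: biquat where "bq_i = Biquat 0 1 0 0"
definition bq_j :: biquat where "bq_j = Biquat 0 0 1 0"
definition bq_k :: biquat where "bq_k = Biquat 0 0 0 1"

lemma bq_unit_sel [simp]: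
  "bq0 bq_i = 0" "bq1 bq_i = 1" "bq2 bq_i = 0" "bq3 bq_i = 0"
  "bq0 bq_j = 0" "bq1 bq_j = 0" "bq2 bq_j = 1" "bq3 bq_j = 0"
  "bq0 bq_k = 0" "bq1 bq_k = 0" "bq2 bq_k = 0" "bq3 bq_k = 1"
  by (simp_all add: bq_i_def bq_j_def bq_k_def)

lemma bq_scalar_decomp:
  "a = bq_scalar (bq0 a) + (bq_scalar (bq1 a) * bq_i + bq_scalar (bq2 a) * bq_j + bq_scalar (bq3 a) * bq_k)"
  by (simp add: biquat_eq_iff)

text \<open>
  The expression is complex linear in \<open>r\<close>, so it vanishes once it does so on a basis.
\<close>

lemma bq_twisted_linear_right:
  fixes a e c :: biquat
  assumes "\<And>r. r \<in> {1, bq_i, bq_j, bq_k} \<Longrightarrow> a * (e * r) + (e * r) * c = 0"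
  shows "a * (e * r) + (e * r) * c = 0"
proof -
  define T where "T r = a * (e * r) + (e * r) * c" for r
  have add: "T (x + y) = T x + T y" for x y
    by (simp add: T_def algebra_simps)
  have sc: "T (bq_scalar x * r) = bq_scalar x * T r" for x r
    by (simp add: biquat_eq_iff T_def algebra_simps)
  have "T 1 = 0" "T bq_i = 0" "T bq_j = 0" "T bq_k = 0"
    unfolding T_def by (rule assms; simp)+
  moreover have "r = bq_scalar (bq0 r) * 1 + (bq_scalar (bq1 r) * bq_i + bq_scalar (bq2 r) * bq_j + bq_scalar (bq3 r) * bq_k)"
    by (simp add: biquat_eq_iff)
  then have "T r = T (bq_scalar (bq0 r) * 1 + (bq_scalar (bq1 r) * bq_i + bq_scalar (bq2 r) * bq_j + bq_scalar (bq3 r) * bq_k))"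
    by simp
  ultimately have "T r = 0"
    by (simp only: add sc mult_zero_right add_0_left)
  then show ?thesis
    by (simp add: T_def)
qed

text \<open>
  Biquaternions have zero divisors, so a non-zero commutator need not be invertible. These
  combinations of a commutator are scalars, and at least one of them is non-zero unless \<open>c\<close> is
  central: the ideal generated by the commutators of a non-central element is everything.
\<close>

lemma bq_commutator_identities:
  defines "w q c \<equiv> c * q - q * c"
  shows "bq_k * w bq_j c + w bq_j c * bq_k = bq_scalar (- 4 * bq1 c)"
    "bq_i * w bq_k c + w bq_k c * bq_i = bq_scalar (- 4 * bq2 c)"
    "bq_j * w bq_i c + w bq_i c * bq_j = bq_scalar (- 4 * bq3 c)"
  by (simp_all add: w_def biquat_eq_iff)

text \<open>
  If \<open>x \<mapsto> a x + x c\<close> kills the whole right ideal generated by \<open>e\<close>, then comparing its values at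
  \<open>e r q\<close> and at \<open>(e r) q\<close>, where \<open>q\<close> is moved past \<open>c\<close>, shows that \<open>e r\<close> annihilates the commutators
  of \<open>c\<close>. Since \<open>r\<close> is arbitrary, \<open>e\<close> annihilates a non-zero scalar.
\<close>

lemma bq_twisted_linear_right_imp_zero:
  fixes a e c :: biquat
  assumes r: "\<And>r. r \<in> {1, bq_i, bq_j, bq_k} \<Longrightarrow> a * (e * r) + (e * r) * c = 0"
    and c: "bq1 c \<noteq> 0 \<or> bq2 c \<noteq> 0 \<or> bq3 c \<noteq> 0"
  shows "e = 0"
proof -
  have T: "a * (e * r) + (e * r) * c = 0" for r
    using bq_twisted_linear_right[OF r] .
  \<comment> \<open>the value at \<open>e * r\<close>, multiplied by \<open>q\<close>, minus the value at \<open>e * r * q\<close>\<close>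
  have comm: "e * r * (c * q - q * c) = 0" for r q
  proof -
    have "e * r * (c * q - q * c) = (a * (e * r) + (e * r) * c) * q - (a * (e * (r * q)) + (e * (r * q)) * c)"
      by (simp add: algebra_simps)
    then show ?thesis
      by (simp only: T) simp
  qed
  have van: "e * (r * (c * q - q * c) + (c * q - q * c) * r) = 0" for r q
  proof -
    have "e * (r * (c * q - q * c) + (c * q - q * c) * r)
        = e * r * (c * q - q * c) + (e * 1 * (c * q - q * c)) * r"
      by (simp only: distrib_left mult.assoc mult_1_left)
    then show ?thesis
      by (simp only: comm) simp
  qed
  have "e * bq_scalar x = 0 \<Longrightarrow> x \<noteq> 0 \<Longrightarrow> e = 0" for x
    by (simp add: biquat_eq_iff)
  moreover have "e * bq_scalar (- 4 * bq1 c) = 0" "e * bq_scalar (- 4 * bq2 c) = 0"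
    "e * bq_scalar (- 4 * bq3 c) = 0"
    using van[of bq_k bq_j] van[of bq_i bq_k] van[of bq_j bq_i]
    by (simp_all only: bq_commutator_identities)
  ultimately show ?thesis
    using c by (metis mult_eq_0_iff neg_equal_0_iff_equal zero_neq_numeral)
qed

text \<open>
  Quaternionic conjugation exchanges left and right ideals.
\<close>

lemma bq_twisted_linear_left_imp_zero:
  fixes a e c :: biquat
  assumes r: "\<And>r. r \<in> {1, bq_i, bq_j, bq_k} \<Longrightarrow> c * (r * e) + (r * e) * a = 0"
    and c: "bq1 c \<noteq> 0 \<or> bq2 c \<noteq> 0 \<or> bq3 c \<noteq> 0"
  shows "e = 0"
proof -
  have "bq_conj a * (bq_conj e * r) + (bq_conj e * r) * bq_conj c = 0"
    if "r \<in> {1, bq_i, bq_j, bq_k}" for r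
  proof -
    have "r = 1 \<and> bq_conj r = 1 \<or> r \<noteq> 1 \<and> bq_conj r = - r"
      using that by (auto simp: biquat_eq_iff)
    moreover have "bq_conj (c * (r * e) + (r * e) * a)
      = bq_conj a * (bq_conj e * bq_conj r) + (bq_conj e * bq_conj r) * bq_conj c"
      by (simp add: biquat_eq_iff algebra_simps)
    moreover have "bq_conj (c * (r * e) + (r * e) * a) = 0"
      by (simp only: r[OF that]) (simp add: biquat_eq_iff)
    ultimately have "bq_conj r = r \<or> bq_conj r = - r"
      "bq_conj a * (bq_conj e * bq_conj r) + (bq_conj e * bq_conj r) * bq_conj c = 0"
      by auto
    moreover have "bq_conj a * (bq_conj e * (- r)) + (bq_conj e * (- r)) * bq_conj c
      = - (bq_conj a * (bq_conj e * r) + (bq_conj e * r) * bq_conj c)"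
      by (simp add: algebra_simps)
    ultimately show ?thesis
      by (metis add.inverse_neutral add.inverse_inverse)
  qed
  then have "bq_conj e = 0"
    by (rule bq_twisted_linear_right_imp_zero) (use c in auto)
  then show ?thesis
    by (simp add: biquat_eq_iff)
qed

section \<open>Slices and circular sets\<close>

text \<open>
  The copy of the complex number \<open>z\<close> in the slice of \<open>I\<close>.
\<close>

definition slice_point :: "quat \<Rightarrow> complex \<Rightarrow> quat"
  where "slice_point I z = of_real (Re z) + I * of_real (Im z)"

definition qvec :: "quat \<Rightarrow> quat"
  where "qvec q = q - of_real (qre q)"

text \<open>
  A quaternion \<open>q\<close> is \<open>slice_point (qdir q) (qcoord q)\<close> with \<open>qcoord q\<close> in the closed upper half plane.
  For real \<open>q\<close> every imaginary unit is a possible direction, and \<open>qdir\<close> takes \<open>quat_i\<close>.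
\<close>

definition qcoord :: "quat \<Rightarrow> complex"
  where "qcoord q = Complex (qre q) (norm (qvec q))"

definition qdir :: "quat \<Rightarrow> quat"
  where "qdir q = (if qvec q = 0 then quat_i else qvec q /\<^sub>R norm (qvec q))"

lemma quat_unit_sel [simp]:
  "qre quat_i = 0" "qim1 quat_i = 1" "qim2 quat_i = 0" "qim3 quat_i = 0"
  "qre quat_j = 0" "qim1 quat_j = 0" "qim2 quat_j = 1" "qim3 quat_j = 0"
  "qre quat_k = 0" "qim1 quat_k = 0" "qim2 quat_k = 0" "qim3 quat_k = 1"
  by (simp_all add: quat_i_def quat_j_def quat_k_def)

lemma imag_units_iff:
  "I \<in> imag_units \<longleftrightarrow> qre I = 0 \<and> (qim1 I)\<^sup>2 + (qim2 I)\<^sup>2 + (qim3 I)\<^sup>2 = 1"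
proof
  assume "I \<in> imag_units"
  then have *: "qre I * qre I - qim1 I * qim1 I - qim2 I * qim2 I - qim3 I * qim3 I = -1"
    "qre I * qim1 I = 0" "qre I * qim2 I = 0" "qre I * qim3 I = 0"
    by (auto simp: imag_units_def quat_eq_iff power2_eq_square)
  have "qre I = 0"
  proof (rule ccontr)
    assume "qre I \<noteq> 0"
    then have "qre I * qre I = -1"
      using * by simp
    then show False
      using zero_le_square[of "qre I"] by linarith
  qed
  then show "qre I = 0 \<and> (qim1 I)\<^sup>2 + (qim2 I)\<^sup>2 + (qim3 I)\<^sup>2 = 1"
    using * by (simp add: power2_eq_square)
next
  assume "qre I = 0 \<and> (qim1 I)\<^sup>2 + (qim2 I)\<^sup>2 + (qim3 I)\<^sup>2 = 1"
  then show "I \<in> imag_units"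
    by (simp add: imag_units_def quat_eq_iff power2_eq_square)
qed

lemma imag_unit_square: "I \<in> imag_units \<Longrightarrow> I * I = - 1"
  by (simp add: imag_units_def power2_eq_square)

lemma imag_unit_square_left: "I \<in> imag_units \<Longrightarrow> I * (I * a) = - a"
  by (metis imag_unit_square mult.assoc mult_minus1)

lemma quat_i_imag_unit [simp]: "quat_i \<in> imag_units"
  by (simp add: imag_units_iff)

lemma uminus_imag_unit [simp]: "- I \<in> imag_units \<longleftrightarrow> I \<in> imag_units"
  by (simp add: imag_units_iff)

lemma qvec_sel [simp]: "qre (qvec q) = 0" "qim1 (qvec q) = qim1 q" "qim2 (qvec q) = qim2 q"
  "qim3 (qvec q) = qim3 q"
  by (simp_all add: qvec_def)

lemma norm_qvec: "norm (qvec q) = sqrt ((qim1 q)\<^sup>2 + (qim2 q)\<^sup>2 + (qim3 q)\<^sup>2)"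
  by (simp add: norm_quat_def)

lemma qdir_imag_unit [simp]: "qdir q \<in> imag_units"
proof (cases "qvec q = 0")
  case True
  then show ?thesis by (simp add: qdir_def)
next
  case False
  define n where "n = norm (qvec q)"
  have n: "n > 0" "n\<^sup>2 = (qim1 q)\<^sup>2 + (qim2 q)\<^sup>2 + (qim3 q)\<^sup>2"
    using False by (auto simp: n_def) (simp add: norm_qvec)
  have "(qim1 q / n)\<^sup>2 + (qim2 q / n)\<^sup>2 + (qim3 q / n)\<^sup>2 = n\<^sup>2 / n\<^sup>2"
    by (simp only: power_divide n(2) add_divide_distrib)
  also have "\<dots> = 1"
    using n(1) by simp
  finally have "(qim1 q / n)\<^sup>2 + (qim2 q / n)\<^sup>2 + (qim3 q / n)\<^sup>2 = 1" .
  then show ?thesis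
    using False n by (simp add: qdir_def imag_units_iff n_def[symmetric] divide_inverse mult.commute)
qed

lemma slice_point_qdir_qcoord [simp]: "slice_point (qdir q) (qcoord q) = q"
proof (cases "qvec q = 0")
  case True
  then have "qim1 q = 0" "qim2 q = 0" "qim3 q = 0"
    by (metis qvec_sel quat_sel_simps(2-4))+
  with True show ?thesis
    by (simp add: slice_point_def qcoord_def quat_eq_iff)
next
  case False
  then have "norm (qvec q) \<noteq> 0" by simp
  with False show ?thesis
    by (simp add: slice_point_def qcoord_def qdir_def quat_eq_iff)
qed

lemma slice_point_uminus: "slice_point (- I) z = slice_point I (cnj z)"
  by (simp add: slice_point_def)

lemma qcoord_slice_point:
  assumes "I \<in> imag_units"
  shows "qcoord (slice_point I z) = Complex (Re z) \<bar>Im z\<bar>"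
proof -
  have "(qim1 I * Im z)\<^sup>2 + (qim2 I * Im z)\<^sup>2 + (qim3 I * Im z)\<^sup>2 = (Im z)\<^sup>2"
    using assms by (simp add: imag_units_iff power_mult_distrib distrib_right[symmetric])
  then show ?thesis
    using assms by (simp add: qcoord_def norm_qvec slice_point_def imag_units_iff)
qed

lemma qcoord_slice_point_cases:
  assumes "I \<in> imag_units"
  shows "qcoord (slice_point I z) = z \<or> qcoord (slice_point I z) = cnj z"
  using assms by (auto simp: qcoord_slice_point complex_eq_iff)

lemma qdir_slice_point:
  assumes "I \<in> imag_units" "Im z \<noteq> 0"
  shows "qdir (slice_point I z) = (if Im z > 0 then I else - I)"
proof -
  have v: "qvec (slice_point I z) = Im z *\<^sub>R I"
    using assms by (simp add: quat_eq_iff slice_point_def imag_units_iff)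
  have "norm I = 1"
    using assms by (simp add: norm_quat_def imag_units_iff)
  moreover from this have "I \<noteq> 0" by auto
  ultimately show ?thesis
    using assms by (simp add: qdir_def v)
qed

text \<open>
  The spheres are the fibres of \<open>qcoord\<close>, so circular sets are preimages under it.
\<close>

lemma qsphere_iff: "p \<in> qsphere q \<longleftrightarrow> qcoord p = qcoord q"
proof
  assume "p \<in> qsphere q"
  then obtain x y J I where *: "J \<in> imag_units" "I \<in> imag_units"
    "p = slice_point J (Complex x y)" "q = slice_point I (Complex x y)"
    by (auto simp: qsphere_def slice_point_def)
  then show "qcoord p = qcoord q"
    by (simp add: qcoord_slice_point)
next
  assume eq: "qcoord p = qcoord q"
  have "p = slice_point (qdir p) (qcoord q)" "q = slice_point (qdir q) (qcoord q)"
    using slice_point_qdir_qcoord[of p] eq by simp_all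
  then show "p \<in> qsphere q"
    unfolding qsphere_def slice_point_def using qdir_imag_unit by blast
qed

lemma circular_iff: "circular A \<longleftrightarrow> (\<forall>p q. p \<in> A \<longrightarrow> qcoord p = qcoord q \<longrightarrow> q \<in> A)"
  by (auto simp: circular_def qsphere_iff subset_iff)

text \<open>
  The intersection with the slice of \<open>quat_i\<close>, read as a set of complex numbers. For a circular set
  all slices give the same set, which is symmetric under complex conjugation.
\<close>

definition section_of :: "quat set \<Rightarrow> complex set"
  where "section_of A = {z. slice_point quat_i z \<in> A}"

lemma circular_slice_point_iff:
  assumes "circular A" "I \<in> imag_units"
  shows "slice_point I z \<in> A \<longleftrightarrow> z \<in> section_of A"
proof -
  have "qcoord (slice_point I z) = qcoord (slice_point quat_i z)"
    using assms by (simp add: qcoord_slice_point)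
  then show ?thesis
    using assms(1) unfolding circular_iff section_of_def by (metis mem_Collect_eq)
qed

lemma circular_mem_iff: "circular A \<Longrightarrow> q \<in> A \<longleftrightarrow> qcoord q \<in> section_of A"
  using circular_slice_point_iff[of A "qdir q" "qcoord q"] by simp

lemma section_of_cnj [simp]: "circular A \<Longrightarrow> cnj z \<in> section_of A \<longleftrightarrow> z \<in> section_of A"
  using circular_slice_point_iff[of A "- quat_i" z] 
  by (simp add: slice_point_uminus section_of_def)

lemma section_of_Int [simp]: "section_of (A \<inter> B) = section_of A \<inter> section_of B"
  by (auto simp: section_of_def)

lemma section_of_mono: "A \<subseteq> B \<Longrightarrow> section_of A \<subseteq> section_of B"
  by (auto simp: section_of_def)

lemma circular_Int: "circular A \<Longrightarrow> circular B \<Longrightarrow> circular (A \<inter> B)"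
  by (auto simp: circular_iff)

lemma circular_qcoord_vimage: "circular (qcoord -` E)"
  by (auto simp: circular_iff)

lemma qcoord_slice_point_in:
  assumes "\<And>z. z \<in> E \<Longrightarrow> cnj z \<in> E" "I \<in> imag_units"
  shows "qcoord (slice_point I z) \<in> E \<longleftrightarrow> z \<in> E"
  using qcoord_slice_point_cases[OF assms(2), of z] assms(1) by (metis complex_cnj_cnj)

lemma section_of_qcoord_vimage:
  assumes "\<And>z. z \<in> E \<Longrightarrow> cnj z \<in> E"
  shows "section_of (qcoord -` E) = E"
  using qcoord_slice_point_in[where E = E and I = quat_i, OF assms] by (simp add: section_of_def)

lemma bounded_linear_qsel:
  "bounded_linear qre" "bounded_linear qim1" "bounded_linear qim2" "bounded_linear qim3"
  by (auto intro!: bounded_linear_intro[where K = 1] real_le_rsqrt simp: norm_quat_def)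

lemmas qsel_continuous [continuous_intros] =
  bounded_linear.continuous_on[OF bounded_linear_qsel(1)]
  bounded_linear.continuous_on[OF bounded_linear_qsel(2)]
  bounded_linear.continuous_on[OF bounded_linear_qsel(3)]
  bounded_linear.continuous_on[OF bounded_linear_qsel(4)]

lemma continuous_qcoord: "continuous_on A qcoord"
proof -
  have "continuous_on A (\<lambda>q. of_real (qre q) + \<i> * of_real (norm (qvec q)))"
    unfolding qvec_def by (intro continuous_intros)
  then show ?thesis
    unfolding qcoord_def Complex_eq .
qed

lemma open_qcoord_vimage: "open E \<Longrightarrow> open (qcoord -` E)"
  using continuous_qcoord[of UNIV] by (simp add: continuous_on_open_vimage)

lemma continuous_slice_point: "continuous_on A (slice_point I)"
  unfolding slice_point_def by (intro continuous_intros)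

lemma open_section_of: "open A \<Longrightarrow> open (section_of A)"
  using continuous_slice_point[of UNIV quat_i] 
  by (simp add: continuous_on_open_vimage section_of_def vimage_def)

section \<open>Stem functions\<close>

text \<open>
  The two components are recovered from the values at \<open>x + \<i> y\<close> and \<open>x - \<i> y\<close> in a single slice. The
  formula makes sense for every function and always yields a symmetric result; it represents \<open>f\<close>
  exactly where \<open>f\<close> is a slice function.
\<close>

definition stem :: "(quat \<Rightarrow> quat) \<Rightarrow> complex \<Rightarrow> biquat"
  where "stem f z = bq_pair
    ((1/2) *\<^sub>R (f (slice_point quat_i z) + f (slice_point quat_i (cnj z))))
    (- (1/2) *\<^sub>R (quat_i * (f (slice_point quat_i z) - f (slice_point quat_i (cnj z)))))"

definition induced :: "(complex \<Rightarrow> biquat) \<Rightarrow> quat \<Rightarrow> quat"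
  where "induced F q = bq_Re (F (qcoord q)) + qdir q * bq_Im (F (qcoord q))"

text \<open>
  The real part is even and the imaginary part is odd in the imaginary coordinate.
\<close>

definition symmetric_stem :: "(complex \<Rightarrow> biquat) \<Rightarrow> bool"
  where "symmetric_stem F \<longleftrightarrow> (\<forall>z. F (cnj z) = bq_cnj (F z))"

lemma symmetric_stem_stem: "symmetric_stem (stem f)"
  by (simp add: symmetric_stem_def stem_def biquat_eq_iff complex_eq_iff algebra_simps)

lemma stem_cnj: "stem f (cnj z) = bq_cnj (stem f z)"
  using symmetric_stem_stem by (simp add: symmetric_stem_def)

text \<open>
  \<open>qcoord\<close> and \<open>qdir\<close> only produce points of the upper half plane; symmetry makes the change of sign
  of \<open>qdir\<close> below the real axis cancel against that of the imaginary part.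
\<close>

lemma induced_slice_point:
  assumes "F (cnj z) = bq_cnj (F z)" "I \<in> imag_units"
  shows "induced F (slice_point I z) = bq_Re (F z) + I * bq_Im (F z)"
proof -
  consider "Im z = 0" | "Im z > 0" | "Im z < 0" by linarith
  then show ?thesis
  proof cases
    case 1
    then have "cnj z = z" by (simp add: complex_eq_iff)
    with assms(1) have "F z = bq_cnj (F z)" by simp
    then have "bq_Im (F z) = 0"
      by (simp add: biquat_eq_iff quat_eq_iff complex_eq_iff)
    moreover have "qcoord (slice_point I z) = z"
      using 1 assms(2) by (simp add: qcoord_slice_point complex_eq_iff)
    ultimately show ?thesis
      by (simp add: induced_def)
  next
    case 2
    then have "qcoord (slice_point I z) = z"
      using assms(2) by (simp add: qcoord_slice_point complex_eq_iff)
    with 2 show ?thesis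
      by (simp add: induced_def qdir_slice_point assms)
  next
    case 3
    then have "qcoord (slice_point I z) = cnj z"
      using assms(2) by (simp add: qcoord_slice_point complex_eq_iff)
    with 3 show ?thesis
      by (simp add: induced_def qdir_slice_point assms)
  qed
qed

lemma stem_eqI:
  assumes "f (slice_point quat_i z) = a + quat_i * b" "f (slice_point quat_i (cnj z)) = a - quat_i * b"
  shows "stem f z = bq_pair a b"
  by (simp add: stem_def assms biquat_eq_iff complex_eq_iff)

lemma stem_induced:
  assumes "symmetric_stem F"
  shows "stem (induced F) z = F z"
proof -
  have "stem (induced F) z = bq_pair (bq_Re (F z)) (bq_Im (F z))"
    using assms induced_slice_point[of F z quat_i] induced_slice_point[of F z "- quat_i"]
    by (intro stem_eqI) (simp_all add: symmetric_stem_def slice_point_uminus)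
  then show ?thesis by simp
qed

lemma induced_stem_slice_point:
  assumes "I \<in> imag_units"
  shows "induced (stem f) (slice_point I z) = bq_Re (stem f z) + I * bq_Im (stem f z)"
  using induced_slice_point[of "stem f" z I] assms by (simp add: stem_cnj)

lemma slice_function_on_iff:
  assumes "circular A"
  shows "slice_function_on f A \<longleftrightarrow> (\<forall>q\<in>A. f q = induced (stem f) q)"
proof
  assume "slice_function_on f A"
  then obtain F1 F2 where F: "\<And>x y. F1 x (- y) = F1 x y" "\<And>x y. F2 x (- y) = - F2 x y"
    "\<And>x y I. I \<in> imag_units \<Longrightarrow> of_real x + I * of_real y \<in> A \<Longrightarrow>
      f (of_real x + I * of_real y) = F1 x y + I * F2 x y"
    unfolding slice_function_on_def by blast
  show "\<forall>q\<in>A. f q = induced (stem f) q"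
  proof
    fix q assume q: "q \<in> A"
    define z where "z = qcoord q"
    have val: "f (slice_point I z) = F1 (Re z) (Im z) + I * F2 (Re z) (Im z)" if "I \<in> imag_units" for I
      using F(3)[OF that, of "Re z" "Im z"] circular_slice_point_iff[OF assms that, of z] q
        circular_mem_iff[OF assms, of q]
      by (simp add: slice_point_def z_def)
    have "stem f z = bq_pair (F1 (Re z) (Im z)) (F2 (Re z) (Im z))"
      using val[of quat_i] val[of "- quat_i"] by (intro stem_eqI) (simp_all add: slice_point_uminus)
    then show "f q = induced (stem f) q"
      using val[of "qdir q"] by (simp add: induced_def z_def)
  qed
next
  assume *: "\<forall>q\<in>A. f q = induced (stem f) q"
  have "bq_Re (stem f (Complex x (- y))) = bq_Re (stem f (Complex x y))"
    "bq_Im (stem f (Complex x (- y))) = - bq_Im (stem f (Complex x y))" for x y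
    using stem_cnj[of f "Complex x y"] by (simp_all add: complex_cnj)
  moreover have "f (of_real x + I * of_real y) = bq_Re (stem f (Complex x y)) + I * bq_Im (stem f (Complex x y))"
    if "I \<in> imag_units" "of_real x + I * of_real y \<in> A" for x y I
    using * that induced_stem_slice_point[OF that(1), of f "Complex x y"]
    by (simp add: slice_point_def)
  ultimately show "slice_function_on f A"
    unfolding slice_function_on_def 
    by (intro exI[of _ "\<lambda>x y. bq_Re (stem f (Complex x y))"] exI[of _ "\<lambda>x y. bq_Im (stem f (Complex x y))"]) blast
qed

lemma stem_add: "stem (\<lambda>q. f q + g q) z = stem f z + stem g z"
  by (simp add: stem_def biquat_eq_iff complex_eq_iff algebra_simps)

lemma stem_const: "stem (\<lambda>_. c) z = bq_pair c 0"
  by (simp add: stem_def biquat_eq_iff complex_eq_iff)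

text \<open>
  Conjugation by \<open>u = f q\<close> moves \<open>q\<close> to the direction \<open>J = u\<^sup>-\<^sup>1 I u\<close>, and \<open>u (c + J d) = u c + I u d\<close>.
  Expanding with \<open>u = a + I b\<close> gives the product of the stems. Where \<open>u = 0\<close>, this expansion is zero as
  well.
\<close>

lemma star_fun_slice_point:
  assumes "I \<in> imag_units"
    and f: "f (slice_point I z) = a + I * b"
    and g: "\<And>J. J \<in> imag_units \<Longrightarrow> g (slice_point J z) = c + J * d"
  shows "star_fun f g (slice_point I z) = (a * c - b * d) + I * (a * d + b * c)"
proof (cases "f (slice_point I z) = 0")
  case True
  have "(a * c - b * d) + I * (a * d + b * c) = (a + I * b) * c + I * ((a + I * b) * d)"
    using assms(1) by (simp add: algebra_simps imag_unit_square_left)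
  with True show ?thesis
    by (simp add: star_fun_def f[symmetric])
next
  case False
  define u where "u = f (slice_point I z)"
  define J where "J = inverse u * I * u"
  have u: "u \<noteq> 0" "u = a + I * b"
    using False f by (simp_all add: u_def)
  have "J * J = inverse u * I * (u * inverse u) * I * u"
    by (simp add: J_def mult.assoc)
  also have "\<dots> = inverse u * (I * I) * u"
    using u by (simp add: mult.assoc)
  also have "\<dots> = -1"
    using u assms(1) by (simp add: imag_unit_square)
  finally have J: "J \<in> imag_units"
    by (simp add: imag_units_def power2_eq_square)
  have "inverse u * slice_point I z * u = of_real (Re z) * (inverse u * u) + J * of_real (Im z)"
    by (simp add: slice_point_def J_def of_real_def algebra_simps)
  then have "inverse u * slice_point I z * u = slice_point J z"
    using u by (simp add: slice_point_def)
  then have "star_fun f g (slice_point I z) = u * (c + J * d)"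
    using u g[OF J] by (simp add: star_fun_def u_def[symmetric])
  also have "\<dots> = u * c + u * inverse u * I * u * d"
    by (simp add: J_def algebra_simps)
  also have "\<dots> = (a + I * b) * c + I * (a + I * b) * d"
    using u(1) by (simp add: u(2)[symmetric])
  also have "\<dots> = (a * c - b * d) + I * (a * d + b * c)"
    using assms(1) by (simp add: algebra_simps imag_unit_square_left)
  finally show ?thesis .
qed

lemma star_fun_stem_slice_point:
  assumes "I \<in> imag_units" "circular A" "circular B" "slice_function_on f A" "slice_function_on g B"
    "z \<in> section_of A" "z \<in> section_of B"
  shows "star_fun f g (slice_point I z) = bq_Re (stem f z * stem g z) + I * bq_Im (stem f z * stem g z)"
proof -
  have "f (slice_point J z) = bq_Re (stem f z) + J * bq_Im (stem f z)"
    "g (slice_point J z) = bq_Re (stem g z) + J * bq_Im (stem g z)" if "J \<in> imag_units" for J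
    using assms that circular_slice_point_iff[of _ J z]
    by (simp_all add: slice_function_on_iff induced_stem_slice_point)
  then show ?thesis
    using star_fun_slice_point[OF assms(1)] assms(1) by (simp add: bq_Re_Im_mult)
qed

lemma stem_star_fun:
  assumes "circular A" "circular B" "slice_function_on f A" "slice_function_on g B"
    "z \<in> section_of A" "z \<in> section_of B"
  shows "stem (star_fun f g) z = stem f z * stem g z"
proof -
  have "stem (star_fun f g) z = bq_pair (bq_Re (stem f z * stem g z)) (bq_Im (stem f z * stem g z))"
    using star_fun_stem_slice_point[OF _ assms, of quat_i]
      star_fun_stem_slice_point[OF _ assms, of "- quat_i"]
    by (intro stem_eqI) (simp_all add: slice_point_uminus)
  then show ?thesis by simp
qed

lemma slice_function_on_star_fun:
  assumes "circular A" "circular B" "slice_function_on f A" "slice_function_on g B"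
  shows "slice_function_on (star_fun f g) (A \<inter> B)"
proof -
  have "star_fun f g q = induced (stem (star_fun f g)) q" if "q \<in> A \<inter> B" for q
  proof -
    have z: "qcoord q \<in> section_of A" "qcoord q \<in> section_of B"
      using that assms by (auto simp: circular_mem_iff)
    then show ?thesis
      using star_fun_stem_slice_point[OF qdir_imag_unit assms z]
      using slice_point_qdir_qcoord[of q] by (metis stem_star_fun[OF assms] induced_def)
  qed
  then show ?thesis
    using assms by (simp add: slice_function_on_iff circular_Int)
qed

section \<open>Slice regularity is holomorphy of the stem\<close>

definition bq_coords :: "(biquat \<Rightarrow> complex) set"
  where "bq_coords = {bq0, bq1, bq2, bq3}"

definition holo_stem_on :: "(complex \<Rightarrow> biquat) \<Rightarrow> complex set \<Rightarrow> bool"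
  where "holo_stem_on F E \<longleftrightarrow> (\<forall>c\<in>bq_coords. (\<lambda>z. c (F z)) holomorphic_on E)"

definition mero_stem_on :: "(complex \<Rightarrow> biquat) \<Rightarrow> complex set \<Rightarrow> bool"
  where "mero_stem_on F E \<longleftrightarrow> (\<forall>c\<in>bq_coords. (\<lambda>z. c (F z)) meromorphic_on E)"

text \<open>
  The Cauchy--Riemann equations: a real linear map that commutes with \<open>\<i>\<close> on \<open>1\<close> is multiplication by
  a complex number.
\<close>

lemma has_field_derivative_of_real_derivative:
  assumes "(f has_derivative D) (at z)" "D \<i> = \<i> * D 1"
  shows "(f has_field_derivative D 1) (at z)"
proof -
  interpret D: bounded_linear D
    using assms(1) by (rule has_derivative_bounded_linear)
  have "D h = D 1 * h" for h
  proof -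
    have "h = Re h *\<^sub>R 1 + Im h *\<^sub>R \<i>"
      by (simp add: complex_eq_iff)
    then have "D h = D (Re h *\<^sub>R 1 + Im h *\<^sub>R \<i>)"
      by (rule arg_cong)
    also have "\<dots> = D 1 * h"
      unfolding D.add D.scaleR assms(2) by (simp add: complex_eq_iff)
    finally show ?thesis .
  qed
  then have "D = (*) (D 1)"
    by (intro ext)
  with assms(1) show ?thesis
    by (simp add: has_field_derivative_def)
qed

lemma slice_regular_on_has_derivative:
  assumes "slice_regular_on f A" "I \<in> imag_units" "slice_point I z \<in> A"
  obtains D where "((\<lambda>w. f (slice_point I w)) has_derivative D) (at z)" "D \<i> = I * D 1"
proof -
  obtain D where D: "((\<lambda>(s, t). f (of_real s + I * of_real t)) has_derivative D) (at (Re z, Im z))"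
    "(1/2) *\<^sub>R (D (1, 0) + I * D (0, 1)) = 0"
    using assms unfolding slice_regular_on_def slice_point_def by blast
  have "((\<lambda>w. (Re w, Im w)) has_derivative (\<lambda>h. (Re h, Im h))) (at z)"
    by (intro derivative_intros has_derivative_ident)
  from has_derivative_compose[OF this D(1)]
  have "((\<lambda>w. f (slice_point I w)) has_derivative (\<lambda>h. D (Re h, Im h))) (at z)"
    by (simp add: slice_point_def)
  moreover have "D (1, 0) + I * D (0, 1) = 0"
    using D(2) by simp
  then have "I * (D (1, 0) + I * D (0, 1)) = 0"
    by simp
  then have "D (0, 1) = I * D (1, 0)"
    using assms(2) by (simp add: distrib_left imag_unit_square_left)
  ultimately show ?thesis
    using that by force
qed

text \<open>
  The stem is a combination of the restrictions of \<open>f\<close> to the slices of \<open>quat_i\<close> and \<open>- quat_i\<close>. Their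
  derivatives \<open>D\<close> and \<open>E\<close> at \<open>\<i>\<close> are \<open>quat_i * D 1\<close> and \<open>- quat_i * E 1\<close>, which is precisely what makes the
  pair of components satisfy the Cauchy--Riemann equations.
\<close>

lemma stem_coordinate_holomorphic:
  assumes "bounded_linear L"
    and f: "slice_regular_on f A" and A: "open A" "circular A"
  shows "(\<lambda>z. Complex (L (bq_Re (stem f z))) (L (bq_Im (stem f z)))) holomorphic_on section_of A"
proof -
  interpret L: bounded_linear L by fact
  define \<phi> where "\<phi> z = of_real (L (bq_Re (stem f z))) + \<i> * of_real (L (bq_Im (stem f z)))" for z
  have "\<exists>d. (\<phi> has_field_derivative d) (at z)" if z: "z \<in> section_of A" for z
  proof -
    have "slice_point quat_i z \<in> A" "slice_point (- quat_i) z \<in> A"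
      using z A by (simp_all add: circular_slice_point_iff)
    then obtain D E where D: "((\<lambda>w. f (slice_point quat_i w)) has_derivative D) (at z)" "D \<i> = quat_i * D 1"
      and E: "((\<lambda>w. f (slice_point (- quat_i) w)) has_derivative E) (at z)" "E \<i> = - quat_i * E 1"
      using slice_regular_on_has_derivative[OF f] by (metis quat_i_imag_unit uminus_imag_unit)
    have "((\<lambda>w. (1/2) *\<^sub>R (f (slice_point quat_i w) + f (slice_point (- quat_i) w))) has_derivative
        (\<lambda>h. (1/2) *\<^sub>R (D h + E h))) (at z)"
      by (intro derivative_intros D E)
    from L.has_derivative[OF this]
    have 1: "((\<lambda>w. L (bq_Re (stem f w))) has_derivative (\<lambda>h. L ((1/2) *\<^sub>R (D h + E h)))) (at z)"
      by (simp add: stem_def slice_point_uminus)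
    have "((\<lambda>w. - (1/2) *\<^sub>R (quat_i * (f (slice_point quat_i w) - f (slice_point (- quat_i) w)))) has_derivative
        (\<lambda>h. - (1/2) *\<^sub>R (quat_i * (D h - E h)))) (at z)"
      by (intro derivative_intros D E)
    from L.has_derivative[OF this]
    have 2: "((\<lambda>w. L (bq_Im (stem f w))) has_derivative (\<lambda>h. L (- (1/2) *\<^sub>R (quat_i * (D h - E h))))) (at z)"
      by (simp add: stem_def slice_point_uminus)
    have "(\<phi> has_derivative (\<lambda>h. of_real (L ((1/2) *\<^sub>R (D h + E h))) +
        \<i> * of_real (L (- (1/2) *\<^sub>R (quat_i * (D h - E h)))))) (at z)"
      unfolding \<phi>_def by (intro derivative_intros 1 2)
    from has_field_derivative_of_real_derivative[OF this] show ?thesis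
      by (simp add: D(2) E(2) algebra_simps imag_unit_square_left L.add L.diff L.neg L.scaleR) blast
  qed
  then have "\<phi> holomorphic_on section_of A"
    using A by (simp add: holomorphic_on_open open_section_of)
  then show ?thesis
    unfolding \<phi>_def Complex_eq .
qed

lemma slice_regular_on_imp_holo_stem:
  assumes "slice_regular_on f A" "open A" "circular A"
  shows "holo_stem_on (stem f) (section_of A)"
  using bounded_linear_qsel[THEN stem_coordinate_holomorphic[OF _ assms]]
  by (simp add: holo_stem_on_def bq_coords_def)

lemma quat_decomp:
  "q = qre q *\<^sub>R 1 + qim1 q *\<^sub>R quat_i + qim2 q *\<^sub>R quat_j + qim3 q *\<^sub>R quat_k"
  by (simp add: quat_eq_iff)

lemma has_derivative_quatI:
  assumes "\<And>L. L \<in> {qre, qim1, qim2, qim3} \<Longrightarrow> ((\<lambda>w. L (f w)) has_derivative (\<lambda>h. L (D h))) F"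
  shows "(f has_derivative D) F"
proof -
  have "((\<lambda>w. qre (f w) *\<^sub>R 1 + qim1 (f w) *\<^sub>R quat_i + qim2 (f w) *\<^sub>R quat_j + qim3 (f w) *\<^sub>R quat_k)
    has_derivative (\<lambda>h. qre (D h) *\<^sub>R 1 + qim1 (D h) *\<^sub>R quat_i + qim2 (D h) *\<^sub>R quat_j + qim3 (D h) *\<^sub>R quat_k)) F"
    by (intro derivative_intros assms) simp_all
  then show ?thesis
    by (simp only: quat_decomp[symmetric])
qed

lemma has_derivative_Re_Im:
  assumes "(f has_field_derivative d) (at z)"
  shows "((\<lambda>w. Re (f w)) has_derivative (\<lambda>h. Re (h * d))) (at z)"
    "((\<lambda>w. Im (f w)) has_derivative (\<lambda>h. Im (h * d))) (at z)"
  using assms unfolding has_field_derivative_def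
  by (auto intro!: derivative_eq_intros simp: mult.commute)

text \<open>
  If \<open>d\<close> is the complex derivative of the stem, then the derivative of \<open>f\<close> along the slice of \<open>I\<close> in the
  direction \<open>h\<close> is the image of \<open>h d\<close> under \<open>p + \<iota> q \<mapsto> p + I q\<close>. This map turns multiplication by \<open>\<iota>\<close>
  into multiplication by \<open>I\<close> from the left.
\<close>

lemma slice_regular_onI:
  assumes f: "slice_function_on f A" "holo_stem_on (stem f) (section_of A)" and A: "open A" "circular A"
  shows "slice_regular_on f A"
  unfolding slice_regular_on_def
proof (intro conjI ballI allI impI f)
  fix I x y assume I: "I \<in> imag_units" and xy: "of_real x + I * of_real y \<in> A"
  define z where "z = Complex x y"
  have E: "open (section_of A)" "z \<in> section_of A"
    using A I xy circular_slice_point_iff[of A I z]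
    by (simp_all add: open_section_of slice_point_def z_def)
  define d where "d = Biquat (deriv (\<lambda>w. bq0 (stem f w)) z) (deriv (\<lambda>w. bq1 (stem f w)) z)
    (deriv (\<lambda>w. bq2 (stem f w)) z) (deriv (\<lambda>w. bq3 (stem f w)) z)"
  have "((\<lambda>w. c (stem f w)) has_field_derivative c d) (at z)" if "c \<in> bq_coords" for c
    using f(2) that E by (auto simp: holo_stem_on_def bq_coords_def d_def intro!: holomorphic_derivI)
  note d = this[THEN has_derivative_Re_Im(1)] this[THEN has_derivative_Re_Im(2)]
  have "((\<lambda>w. bq_Re (stem f w)) has_derivative (\<lambda>h. bq_Re (bq_scalar h * d))) (at z)"
    "((\<lambda>w. bq_Im (stem f w)) has_derivative (\<lambda>h. bq_Im (bq_scalar h * d))) (at z)"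
    using d[of bq0] d[of bq1] d[of bq2] d[of bq3]
    by (auto intro!: has_derivative_quatI simp: bq_coords_def)
  then have "((\<lambda>w. bq_Re (stem f w) + I * bq_Im (stem f w)) has_derivative
      (\<lambda>h. bq_Re (bq_scalar h * d) + I * bq_Im (bq_scalar h * d))) (at z)"
    by (intro derivative_intros)
  then have der: "((\<lambda>w. f (slice_point I w)) has_derivative
      (\<lambda>h. bq_Re (bq_scalar h * d) + I * bq_Im (bq_scalar h * d))) (at z)"
  proof (rule has_derivative_transform_within_open[OF _ E])
    fix w assume "w \<in> section_of A"
    then show "bq_Re (stem f w) + I * bq_Im (stem f w) = f (slice_point I w)"
      using A I f(1) circular_slice_point_iff[of A I w]
      by (simp add: slice_function_on_iff induced_stem_slice_point)
  qed
  have pair: "((\<lambda>p. of_real (fst p) + \<i> * of_real (snd p)) has_derivative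
      (\<lambda>h. of_real (fst h) + \<i> * of_real (snd h))) (at (x, y))"
    by (intro derivative_intros has_derivative_ident)
  have z_eq: "z = of_real (fst (x, y)) + \<i> * of_real (snd (x, y))"
    by (simp add: z_def Complex_eq)
  from has_derivative_compose[OF pair der[unfolded z_eq]]
  have "((\<lambda>(s, t). f (of_real s + I * of_real t)) has_derivative
      (\<lambda>h. bq_Re (bq_scalar (of_real (fst h) + \<i> * of_real (snd h)) * d)
         + I * bq_Im (bq_scalar (of_real (fst h) + \<i> * of_real (snd h)) * d))) (at (x, y))"
    by (simp add: slice_point_def case_prod_unfold)
  moreover have "bq_Re (bq_scalar \<i> * d) = - bq_Im d" "bq_Im (bq_scalar \<i> * d) = bq_Re d"
    by (simp_all add: quat_eq_iff)
  then have "(1/2) *\<^sub>R ((bq_Re (bq_scalar 1 * d) + I * bq_Im (bq_scalar 1 * d)) +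
      I * (bq_Re (bq_scalar \<i> * d) + I * bq_Im (bq_scalar \<i> * d))) = 0"
    using I by (simp add: algebra_simps imag_unit_square_left)
  ultimately show "\<exists>D. ((\<lambda>(s, t). f (of_real s + I * of_real t)) has_derivative D) (at (x, y)) \<and>
      (1/2) *\<^sub>R (D (1, 0) + I * D (0, 1)) = 0"
    by (intro exI conjI) (assumption, simp)
qed

lemma slice_regular_on_iff:
  assumes "open A" "circular A"
  shows "slice_regular_on f A \<longleftrightarrow> slice_function_on f A \<and> holo_stem_on (stem f) (section_of A)"
  using assms slice_regular_onI slice_regular_on_imp_holo_stem
  by (auto simp: slice_regular_on_def)

section \<open>Semi-regularity is meromorphy of the stem\<close>

lemma slice_point_mult:
  assumes "I \<in> imag_units"
  shows "slice_point I (z * w) = slice_point I z * slice_point I w"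
proof -
  have "slice_point I v = Re v *\<^sub>R 1 + Im v *\<^sub>R I" for v
    by (simp add: slice_point_def of_real_def)
  then show ?thesis
    using assms by (simp add: algebra_simps imag_unit_square)
qed

lemma slice_point_power:
  assumes "I \<in> imag_units"
  shows "slice_point I (z ^ m) = slice_point I z ^ m"
proof (induction m)
  case 0
  then show ?case by (simp add: slice_point_def)
next
  case (Suc m)
  then show ?case using assms by (simp add: slice_point_mult)
qed

text \<open>
  The polynomial of a sphere in the coordinate of a slice.
\<close>

definition conj_quadratic :: "complex \<Rightarrow> complex \<Rightarrow> complex"
  where "conj_quadratic c z = (z - c) * (z - cnj c)"

lemma sphere_poly_slice_point:
  assumes "I \<in> imag_units"
  shows "sphere_poly p (slice_point I z) = slice_point I (conj_quadratic (qcoord p) z)"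
proof -
  define c where "c = qcoord p"
  have c: "Re c = qre p" "(norm p)\<^sup>2 = (Re c)\<^sup>2 + (Im c)\<^sup>2"
    by (simp_all add: c_def qcoord_def norm_qvec norm_quat_def)
  have "slice_point I (conj_quadratic c z) = slice_point I (z * z - of_real (2 * Re c) * z + of_real ((norm p)\<^sup>2))"
    by (rule arg_cong[of _ _ "slice_point I"])
      (simp add: conj_quadratic_def complex_eq_iff algebra_simps c(2)[unfolded power2_eq_square] power2_eq_square)
  also have "\<dots> = slice_point I z * slice_point I z - of_real (2 * Re c) * slice_point I z + of_real ((norm p)\<^sup>2)"
    unfolding slice_point_mult[OF assms, symmetric]
    by (simp add: slice_point_def of_real_def algebra_simps)
  finally show ?thesis
    by (simp add: sphere_poly_def c_def[symmetric] c(1) power2_eq_square)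
qed

lemma slice_point_times_stem_value:
  assumes "I \<in> imag_units"
  shows "slice_point I w * (bq_Re a + I * bq_Im a) = bq_Re (bq_scalar w * a) + I * bq_Im (bq_scalar w * a)"
proof -
  have "bq_Re (bq_scalar w * a) = Re w *\<^sub>R bq_Re a - Im w *\<^sub>R bq_Im a"
    "bq_Im (bq_scalar w * a) = Re w *\<^sub>R bq_Im a + Im w *\<^sub>R bq_Re a"
    by (simp_all add: quat_eq_iff)
  then show ?thesis
    using assms
    by (simp add: slice_point_def of_real_def algebra_simps imag_unit_square_left)
qed

lemma slice_point_decomp:
  "f (slice_point quat_i z) = bq_Re (stem f z) + quat_i * bq_Im (stem f z)"
  by (simp add: stem_def quat_eq_iff field_simps)

lemma stem_scalar_multiple:
  assumes "h (slice_point quat_i z) = slice_point quat_i w * f (slice_point quat_i z)"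
    "h (slice_point quat_i (cnj z)) = slice_point quat_i (cnj w) * f (slice_point quat_i (cnj z))"
  shows "stem h z = bq_scalar w * stem f z"
proof -
  have "h (slice_point quat_i z) = bq_Re (bq_scalar w * stem f z) + quat_i * bq_Im (bq_scalar w * stem f z)"
    unfolding assms(1) slice_point_decomp[of f] by (rule slice_point_times_stem_value) simp
  moreover have "h (slice_point quat_i (cnj z)) = bq_Re (bq_scalar (cnj w) * bq_cnj (stem f z))
      + quat_i * bq_Im (bq_scalar (cnj w) * bq_cnj (stem f z))"
    unfolding assms(2) slice_point_decomp[of f] stem_cnj by (rule slice_point_times_stem_value) simp
  moreover have "bq_scalar (cnj w) * bq_cnj (stem f z) = bq_cnj (bq_scalar w * stem f z)"
    by simp
  ultimately have "stem h z = bq_pair (bq_Re (bq_scalar w * stem f z)) (bq_Im (bq_scalar w * stem f z))"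
    by (intro stem_eqI) (simp_all only: bq_Re_Im_cnj mult_minus_right diff_conv_add_uminus)
  then show ?thesis by simp
qed

lemma holo_stem_imp_mero_stem:
  "holo_stem_on F E \<Longrightarrow> open E \<Longrightarrow> mero_stem_on F E"
  by (auto simp: holo_stem_on_def mero_stem_on_def intro!: analytic_on_imp_meromorphic_on
      simp: analytic_on_open)

lemma mero_stem_on_pointwise: "mero_stem_on F E \<longleftrightarrow> (\<forall>z\<in>E. mero_stem_on F {z})"
  unfolding mero_stem_on_def by (subst meromorphic_on_meromorphic_at) blast

lemma mero_stem_on_subset: "mero_stem_on F E \<Longrightarrow> E' \<subseteq> E \<Longrightarrow> mero_stem_on F E'"
  unfolding mero_stem_on_def by (blast intro: meromorphic_on_subset)

lemma conj_quadratic_eq_0_iff [simp]: "conj_quadratic c z = 0 \<longleftrightarrow> z = c \<or> z = cnj c"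
  by (simp add: conj_quadratic_def)

lemma conj_quadratic_cnj [simp]: "conj_quadratic c (cnj z) = cnj (conj_quadratic c z)"
  by (simp add: conj_quadratic_def mult.commute)

text \<open>
  Near a missing sphere, the stem of \<open>f\<close> is the holomorphic stem of the extension, divided by a power
  of the quadratic polynomial that vanishes on the sphere.
\<close>

lemma semiregular_reps_stem:
  assumes \<Omega>: "open \<Omega>" "circular \<Omega>" and Af: "(A, f) \<in> semiregular_reps \<Omega>"
  shows "mero_stem_on (stem f) (section_of \<Omega>)" "\<forall>\<^sub>\<approx>z\<in>section_of \<Omega>. z \<in> section_of A"
proof -
  have A: "A \<subseteq> \<Omega>" "open A" "circular A" "slice_regular_on f A"
    and ext: "\<And>p. p \<in> \<Omega> - A \<Longrightarrow> \<exists>U h. \<exists>m::nat. open U \<and> circular U \<and> p \<in> U \<and> U \<subseteq> \<Omega> \<and> U - qsphere p \<subseteq> A \<and>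
      slice_regular_on h U \<and> (\<forall>q\<in>U - qsphere p. h q = sphere_poly p q ^ m * f q)"
    using Af by (auto simp: semiregular_reps_def)
  have *: "mero_stem_on (stem f) {z} \<and> eventually (\<lambda>w. w \<in> section_of A) (at z)"
    if z: "z \<in> section_of \<Omega>" for z
  proof (cases "z \<in> section_of A")
    case True
    then have "eventually (\<lambda>w. w \<in> section_of A) (at z)"
      using A by (intro eventually_at_in_open') (auto simp: open_section_of)
    moreover have "mero_stem_on (stem f) (section_of A)"
      using A by (intro holo_stem_imp_mero_stem slice_regular_on_imp_holo_stem open_section_of)
    ultimately show ?thesis
      using True mero_stem_on_subset by blast
  next
    case False
    define p where "p = slice_point quat_i z"
    have "p \<in> \<Omega> - A"
      using z False by (simp add: section_of_def p_def)
    from ext[OF this] obtain U h and m :: nat where U: "open U" "circular U" "p \<in> U" "U \<subseteq> \<Omega>"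
      "U - qsphere p \<subseteq> A" "slice_regular_on h U"
      and h: "\<And>q. q \<in> U - qsphere p \<Longrightarrow> h q = sphere_poly p q ^ m * f q"
      by (elim exE conjE) (rule that, assumption+, blast)
    have c: "qcoord p = z \<or> qcoord p = cnj z"
      by (simp add: p_def qcoord_slice_point_cases)
    have zU: "z \<in> section_of U"
      using U by (simp add: section_of_def p_def)
    have mero_h: "mero_stem_on (stem h) (section_of U)"
      using U by (intro holo_stem_imp_mero_stem slice_regular_on_imp_holo_stem open_section_of)
    have in_A: "slice_point quat_i w \<in> U - qsphere p" if "w \<in> section_of U" "w \<noteq> z" "w \<noteq> cnj z" for w
    proof -
      have "cnj w \<noteq> z"
        using that by (metis complex_cnj_cnj)
      then have "qcoord (slice_point quat_i w) \<noteq> qcoord p"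
        using c that qcoord_slice_point_cases[of quat_i w] by auto
      then show ?thesis
        using that by (simp add: section_of_def qsphere_iff)
    qed
    have eq: "c (stem f w) = c (stem h w) / conj_quadratic z w ^ m"
      if w: "w \<in> section_of U" "w \<noteq> z" "w \<noteq> cnj z" and "c \<in> bq_coords" for w c
    proof -
      have "conj_quadratic (qcoord p) v = conj_quadratic z v" for v
        using c by (auto simp: conj_quadratic_def)
      moreover have "cnj w \<in> section_of U" "cnj w \<noteq> z" "cnj w \<noteq> cnj z"
        using w U by (simp_all, metis complex_cnj_cnj)
      ultimately have "stem h w = bq_scalar (conj_quadratic z w ^ m) * stem f w"
        using in_A[OF w] in_A[of "cnj w"]
        by (intro stem_scalar_multiple) (simp_all add: h sphere_poly_slice_point slice_point_power del: Diff_iff)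
      then have "c (stem h w) = conj_quadratic z w ^ m * c (stem f w)"
        using \<open>c \<in> bq_coords\<close> by (auto simp: bq_coords_def)
      moreover have "conj_quadratic z w \<noteq> 0"
        using w by simp
      ultimately show ?thesis
        by simp
    qed
    have "eventually (\<lambda>w. w \<in> section_of U \<and> w \<noteq> cnj z) (at z)"
    proof (cases "z = cnj z")
      case True
      then show ?thesis
        using eventually_at_in_open[of "section_of U" z] zU U
        by (auto simp: open_section_of elim!: eventually_mono)
    next
      case False
      then show ?thesis
        using eventually_at_in_open'[of "section_of U - {cnj z}" z] zU U
        by (auto simp: open_section_of open_delete)
    qed
    then have ev: "eventually (\<lambda>w. w \<in> section_of U \<and> w \<noteq> z \<and> w \<noteq> cnj z) (at z)"
      using eventually_neq_at_within[of z z UNIV] by eventually_elim auto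
    then have "eventually (\<lambda>w. w \<in> section_of A) (at z)"
      by eventually_elim (use in_A U(5) in \<open>auto simp: section_of_def\<close>)
    moreover have "(\<lambda>w. c (stem f w)) meromorphic_on {z}" if "c \<in> bq_coords" for c
    proof -
      have "(\<lambda>w. c (stem h w)) meromorphic_on {z}"
        using mero_h zU that by (auto simp: mero_stem_on_def intro: meromorphic_on_subset)
      then have "(\<lambda>w. c (stem h w) / conj_quadratic z w ^ m) meromorphic_on {z}"
        unfolding conj_quadratic_def by (intro meromorphic_intros)
      moreover have "eventually (\<lambda>w. c (stem f w) = c (stem h w) / conj_quadratic z w ^ m) (at z)"
        using ev by eventually_elim (use eq that in auto)
      ultimately show ?thesis
        by (subst meromorphic_on_cong[OF _ refl]) auto
    qed
    ultimately show ?thesis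
      by (simp add: mero_stem_on_def)
  qed
  then show "mero_stem_on (stem f) (section_of \<Omega>)"
    by (subst mero_stem_on_pointwise) blast
  show "\<forall>\<^sub>\<approx>z\<in>section_of \<Omega>. z \<in> section_of A"
    using * \<Omega> by (simp add: eventually_cosparse_open_eq open_section_of)
qed

text \<open>
  All large exponents work, so that one exponent serves several functions and several points.
\<close>

lemma meromorphic_times_power_tendsto:
  assumes "f meromorphic_on {z}" "g analytic_on {z}"
  shows "\<forall>\<^sub>F m in sequentially. \<exists>l. (\<lambda>w. ((w - z) * g w) ^ m * f w) \<midarrow>z\<rightarrow> l"
proof -
  obtain L where L: "(\<lambda>w. f (z + w)) has_laurent_expansion L"
    using assms by (auto simp: meromorphic_on_def)
  have "\<exists>l. (\<lambda>w. ((w - z) * g w) ^ m * f w) \<midarrow>z\<rightarrow> l" if m: "m \<ge> nat (- fls_subdegree L)" for m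
  proof -
    have "(\<lambda>w. w ^ m * f (z + w)) has_laurent_expansion fls_X ^ m * L"
      by (intro laurent_expansion_intros L)
    then have "(\<lambda>w. (\<lambda>v. (v - z) ^ m * f v) (z + w)) has_laurent_expansion fls_X ^ m * L"
      by simp
    moreover have "fls_subdegree (fls_X ^ m * L) \<ge> 0"
      using m by (cases "L = 0") (auto simp: fls_subdegree_pow)
    ultimately have "(\<lambda>v. (v - z) ^ m * f v) \<midarrow>z\<rightarrow> fls_nth (fls_X ^ m * L) 0"
      by (rule has_laurent_expansion_imp_tendsto)
    moreover have "(\<lambda>w. g w ^ m) \<midarrow>z\<rightarrow> g z ^ m"
      using assms(2) by (intro tendsto_intros) (simp add: analytic_at_imp_isCont isContD)
    ultimately have "(\<lambda>w. g w ^ m * ((w - z) ^ m * f w)) \<midarrow>z\<rightarrow> g z ^ m * fls_nth (fls_X ^ m * L) 0"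
      by (rule tendsto_mult[rotated])
    then show ?thesis
      by (auto simp: power_mult_distrib mult_ac)
  qed
  then show ?thesis
    by (auto simp: eventually_sequentially)
qed

lemma dist_cnj [simp]: "dist (cnj z) (cnj w) = dist z w"
  by (simp add: dist_norm flip: complex_cnj_diff)

lemma at_cnj: "filtermap cnj (at z) = at (cnj z)"
proof (rule filter_eqI)
  fix P
  have "(\<forall>w. w \<noteq> z \<and> dist w z < d \<longrightarrow> P (cnj w)) \<longleftrightarrow> (\<forall>w. w \<noteq> cnj z \<and> dist w (cnj z) < d \<longrightarrow> P w)" for d
    by (metis complex_cnj_cnj dist_cnj)
  then show "eventually P (filtermap cnj (at z)) = eventually P (at (cnj z))"
    by (simp add: eventually_filtermap eventually_at)
qed

text \<open>
  Removing singularities preserves the symmetry of stems.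
\<close>

lemma remove_sings_cnj:
  assumes "\<And>w. f (cnj w) = cnj (f w)"
  shows "remove_sings f (cnj z) = cnj (remove_sings f z)"
proof -
  have comp: "remove_sings f (cnj z) = remove_sings (\<lambda>w. cnj (f w)) z"
    using remove_sings_compose[OF at_cnj, of f z] by (simp add: o_def assms)
  show ?thesis
  proof (cases "\<exists>c. f \<midarrow>z\<rightarrow> c")
    case True
    then obtain c where c: "f \<midarrow>z\<rightarrow> c" by blast
    then have "(\<lambda>w. cnj (f w)) \<midarrow>z\<rightarrow> cnj c"
      by (rule tendsto_cnj)
    with c show ?thesis
      unfolding comp by (simp add: remove_sings_eqI)
  next
    case False
    then have "\<not> (\<exists>c. (\<lambda>w. cnj (f w)) \<midarrow>z\<rightarrow> c)"
      using tendsto_cnj[of "\<lambda>w. cnj (f w)"] by auto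
    with False show ?thesis
      unfolding comp by (simp add: remove_sings_def)
  qed
qed

lemma analytic_on_bq_coord:
  "holo_stem_on F E \<Longrightarrow> open E \<Longrightarrow> z \<in> E \<Longrightarrow> c \<in> bq_coords \<Longrightarrow> (\<lambda>w. c (F w)) analytic_on {z}"
  unfolding holo_stem_on_def by (metis analytic_at)

text \<open>
  Conversely, multiplying the stem by a high power of the quadratic polynomial cancels the poles of all
  four coordinates at both points of the sphere. Removing the remaining singularities leaves a holomorphic
  symmetric stem, which induces the required extension of \<open>f\<close>.
\<close>

lemma semiregular_reps_extension:
  assumes \<Omega>: "open \<Omega>" "circular \<Omega>"
    and A: "A \<subseteq> \<Omega>" "open A" "circular A" "slice_regular_on f A"
    and mero: "mero_stem_on (stem f) (section_of \<Omega>)"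
    and cosparse: "\<forall>\<^sub>\<approx>z\<in>section_of \<Omega>. z \<in> section_of A"
    and p: "p \<in> \<Omega>"
  shows "\<exists>U h. \<exists>m::nat. open U \<and> circular U \<and> p \<in> U \<and> U \<subseteq> \<Omega> \<and> U - qsphere p \<subseteq> A \<and>
      slice_regular_on h U \<and> (\<forall>q\<in>U - qsphere p. h q = sphere_poly p q ^ m * f q)"
proof -
  define c where "c = qcoord p"
  have c: "c \<in> section_of \<Omega>" "cnj c \<in> section_of \<Omega>" "Im c \<ge> 0"
    using p \<Omega> by (simp_all add: c_def circular_mem_iff[symmetric]) (simp add: qcoord_def)
  have "eventually (\<lambda>z. z \<in> section_of A \<and> z \<in> section_of \<Omega>) (at c)"
    using cosparse c \<Omega> eventually_at_in_open'[of "section_of \<Omega>" c]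
    by (auto intro!: eventually_conj simp: eventually_cosparse_open_eq open_section_of)
  then obtain r where r: "r > 0" "\<And>z. z \<noteq> c \<Longrightarrow> dist z c < r \<Longrightarrow> z \<in> section_of A \<and> z \<in> section_of \<Omega>"
    unfolding eventually_at by auto
  \<comment> \<open>a symmetric neighbourhood of both points, so that it is the section of a circular set\<close>
  define E where "E = ball c r \<union> ball (cnj c) r"
  have E: "open E" "c \<in> E" "cnj c \<in> E"
    using r(1) by (auto simp: E_def)
  have E_cnj: "cnj z \<in> E" if "z \<in> E" for z
    using that dist_cnj[of c z] dist_cnj[of "cnj c" z] by (auto simp: E_def)
  have E_A: "z \<in> section_of A" if "z \<in> E" "z \<noteq> c" "z \<noteq> cnj c" for z
  proof (cases "z \<in> ball c r")
    case True
    then show ?thesis using r(2)[of z] that by (simp add: dist_commute)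
  next
    case False
    then have "dist (cnj z) c < r"
      using that by (metis E_def Un_iff complex_cnj_cnj dist_cnj dist_commute mem_ball)
    moreover have "cnj z \<noteq> c"
      using that by (metis complex_cnj_cnj)
    ultimately have "cnj z \<in> section_of A" using r(2)[of "cnj z"] by blast
    then show ?thesis using A by simp
  qed
  have E_\<Omega>: "z \<in> section_of \<Omega>" if "z \<in> E" for z
    using E_A[OF that] c section_of_mono[OF A(1)] by auto
  define U where "U = qcoord -` E"
  have U: "open U" "circular U" "section_of U = E"
    using E E_cnj by (auto simp: U_def open_qcoord_vimage circular_qcoord_vimage section_of_qcoord_vimage)
  have U_A: "qcoord q \<noteq> c \<and> qcoord q \<noteq> cnj c" if "q \<notin> qsphere p" for q
  proof -
    have "qcoord q \<noteq> c" "Im (qcoord q) \<ge> 0"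
      using that by (simp_all add: qsphere_iff c_def) (simp add: qcoord_def)
    then show ?thesis
      using c(3) by (auto simp: complex_eq_iff)
  qed
  \<comment> \<open>a power of the quadratic that cancels the poles of all coordinates at both points\<close>
  have "\<forall>\<^sub>F m in sequentially. \<forall>x\<in>bq_coords. \<forall>z\<in>{c, cnj c}.
      \<exists>l. (\<lambda>w. conj_quadratic c w ^ m * x (stem f w)) \<midarrow>z\<rightarrow> l"
  proof (intro eventually_ball_finite ballI)
    fix x z assume x: "x \<in> bq_coords" and z: "z \<in> {c, cnj c}"
    have "(\<lambda>w. x (stem f w)) meromorphic_on {z}"
      using mero x z c by (auto simp: mero_stem_on_def intro: meromorphic_on_subset)
    moreover have "(\<lambda>w. w - cnj z) analytic_on {z}"
      by (intro analytic_intros)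
    ultimately have "\<forall>\<^sub>F m in sequentially. \<exists>l. (\<lambda>w. ((w - z) * (w - cnj z)) ^ m * x (stem f w)) \<midarrow>z\<rightarrow> l"
      by (rule meromorphic_times_power_tendsto)
    moreover have "(w - z) * (w - cnj z) = conj_quadratic c w" for w
      using z by (auto simp: conj_quadratic_def)
    ultimately show "\<forall>\<^sub>F m in sequentially. \<exists>l. (\<lambda>w. conj_quadratic c w ^ m * x (stem f w)) \<midarrow>z\<rightarrow> l"
      by simp
  qed (simp_all add: bq_coords_def)
  from eventually_happens'[OF sequentially_bot this] obtain m where
    m: "\<forall>x\<in>bq_coords. \<forall>z\<in>{c, cnj c}.
      \<exists>l. (\<lambda>w. conj_quadratic c w ^ m * x (stem f w)) \<midarrow>z\<rightarrow> l"
    by (rule exE)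
  define \<psi> where "\<psi> x w = conj_quadratic c w ^ m * x (stem f w)" for x :: "biquat \<Rightarrow> complex" and w
  define H where "H z = Biquat (remove_sings (\<psi> bq0) z) (remove_sings (\<psi> bq1) z)
    (remove_sings (\<psi> bq2) z) (remove_sings (\<psi> bq3) z)" for z
  have H: "x (H z) = remove_sings (\<psi> x) z" if "x \<in> bq_coords" for x z
    using that by (auto simp: H_def bq_coords_def)
  have "remove_sings (\<psi> x) (cnj z) = cnj (remove_sings (\<psi> x) z)" if "x \<in> bq_coords" for x z
    using that by (intro remove_sings_cnj) (auto simp: \<psi>_def bq_coords_def stem_cnj)
  then have H_sym: "symmetric_stem H"
    by (simp add: symmetric_stem_def H_def biquat_eq_iff bq_coords_def)
  have quad: "(\<lambda>w. conj_quadratic c w ^ m) analytic_on {z}" for z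
    unfolding conj_quadratic_def by (intro analytic_intros)
  have \<psi>_A: "\<psi> x analytic_on {z}" if "x \<in> bq_coords" "z \<in> section_of A" for x z
    unfolding \<psi>_def using that A
    by (intro analytic_on_mult quad analytic_on_bq_coord[OF slice_regular_on_imp_holo_stem[OF A(4)]])
      (simp_all add: open_section_of)
  have H_holo: "holo_stem_on H E"
    unfolding holo_stem_on_def
  proof
    fix x assume x: "x \<in> bq_coords"
    have "remove_sings (\<psi> x) analytic_on {z}" if "z \<in> E" for z
    proof (cases "z \<in> section_of A")
      case True
      then show ?thesis
        using \<psi>_A x remove_sings_analytic_on by blast
    next
      case False
      then have z: "z \<in> {c, cnj c}" using E_A that by blast
      then obtain l where "\<psi> x \<midarrow>z\<rightarrow> l"
        using bspec[OF bspec[OF m x] z] unfolding \<psi>_def by blast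
      moreover have "(\<lambda>w. x (stem f w)) meromorphic_on {z}"
        using mero x E_\<Omega>[OF that] by (auto simp: mero_stem_on_def intro: meromorphic_on_subset)
      then have "\<psi> x meromorphic_on {z}"
        unfolding \<psi>_def by (intro meromorphic_on_mult analytic_on_imp_meromorphic_on[OF quad])
      ultimately show ?thesis
        by (intro remove_sings_analytic_at) (auto simp: meromorphic_at_iff)
    qed
    then have "remove_sings (\<psi> x) analytic_on E"
      using analytic_on_analytic_at by blast
    then show "(\<lambda>z. x (H z)) holomorphic_on E"
      using H[OF x] by (simp add: analytic_imp_holomorphic)
  qed
  have st: "stem (induced H) = H"
    using stem_induced[OF H_sym] by blast
  have "slice_regular_on (induced H) U"
    using U H_holo by (simp add: slice_regular_on_iff slice_function_on_iff st)
  moreover have "U \<subseteq> \<Omega>"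
    using E_\<Omega> \<Omega> by (auto simp: U_def circular_mem_iff)
  moreover have UA: "U - qsphere p \<subseteq> A"
    using E_A U_A A by (auto simp: U_def circular_mem_iff[of A])
  moreover have "p \<in> U"
    using E by (simp add: U_def c_def)
  moreover have "induced H q = sphere_poly p q ^ m * f q" if q: "q \<in> U - qsphere p" for q
  proof -
    define z I where "z = qcoord q" and "I = qdir q"
    have I: "I \<in> imag_units" and q_eq: "q = slice_point I z"
      by (simp_all add: z_def I_def)
    have qA: "q \<in> A"
      using UA q by blast
    then have zA: "z \<in> section_of A"
      using A by (simp add: z_def circular_mem_iff)
    have "H z = bq_scalar (conj_quadratic c z ^ m) * stem f z"
      using \<psi>_A[OF _ zA] by (simp add: H_def biquat_eq_iff bq_coords_def) (simp add: \<psi>_def)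
    then have "induced H q = slice_point I (conj_quadratic c z ^ m) * (bq_Re (stem f z) + I * bq_Im (stem f z))"
      using I by (simp add: induced_def z_def[symmetric] I_def[symmetric] slice_point_times_stem_value)
    also have "slice_point I (conj_quadratic c z ^ m) = sphere_poly p q ^ m"
      using I by (simp add: slice_point_power q_eq sphere_poly_slice_point c_def)
    also have "bq_Re (stem f z) + I * bq_Im (stem f z) = f q"
      using A qA unfolding slice_regular_on_def
      by (simp add: slice_function_on_iff induced_def z_def I_def)
    finally show ?thesis .
  qed
  ultimately show ?thesis
    using U by blast
qed

lemma semiregular_reps_iff:
  assumes \<Omega>: "open \<Omega>" "circular \<Omega>"
  shows "(A, f) \<in> semiregular_reps \<Omega> \<longleftrightarrow> A \<subseteq> \<Omega> \<and> open A \<and> circular A \<and>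
    slice_function_on f A \<and> holo_stem_on (stem f) (section_of A) \<and>
    mero_stem_on (stem f) (section_of \<Omega>) \<and> (\<forall>\<^sub>\<approx>z\<in>section_of \<Omega>. z \<in> section_of A)"
    (is "?L \<longleftrightarrow> ?R")
proof
  assume L: ?L
  then have "A \<subseteq> \<Omega>" "open A" "circular A" "slice_regular_on f A"
    by (auto simp: semiregular_reps_def)
  then show ?R
    using semiregular_reps_stem[OF \<Omega> L] by (simp add: slice_regular_on_iff)
next
  assume R: ?R
  then have reg: "slice_regular_on f A"
    by (simp add: slice_regular_on_iff)
  have ext: "\<forall>p\<in>\<Omega> - A. \<exists>U h. \<exists>m::nat. open U \<and> circular U \<and> p \<in> U \<and> U \<subseteq> \<Omega> \<and> U - qsphere p \<subseteq> A \<and>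
      slice_regular_on h U \<and> (\<forall>q\<in>U - qsphere p. h q = sphere_poly p q ^ m * f q)"
    using R reg by (intro ballI semiregular_reps_extension[OF \<Omega>]) blast+
  show ?L
    unfolding semiregular_reps_def mem_Collect_eq case_prod_conv
    by (intro conjI ext reg) (use R in simp_all)
qed

section \<open>Semi-regular functions as classes of meromorphic stems\<close>

definition stems :: "quat set \<Rightarrow> (complex \<Rightarrow> biquat) set"
  where "stems \<Omega> = {F. symmetric_stem F \<and> mero_stem_on F (section_of \<Omega>)}"

definition stem_eq :: "quat set \<Rightarrow> (complex \<Rightarrow> biquat) \<Rightarrow> (complex \<Rightarrow> biquat) \<Rightarrow> bool"
  where "stem_eq \<Omega> F G \<longleftrightarrow> (\<forall>\<^sub>\<approx>z\<in>section_of \<Omega>. F z = G z)"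

text \<open>
  The element of \<open>SEM\<close> with stem \<open>F\<close>: all representatives whose stem agrees with \<open>F\<close> off a sparse set.
\<close>

definition stem_class :: "quat set \<Rightarrow> (complex \<Rightarrow> biquat) \<Rightarrow> semireg"
  where "stem_class \<Omega> F = {(B, g) \<in> semiregular_reps \<Omega>. stem_eq \<Omega> (stem g) F}"

lemma stem_eq_refl [simp]: "stem_eq \<Omega> F F"
  by (simp add: stem_eq_def)

lemma stem_eq_sym: "stem_eq \<Omega> F G \<Longrightarrow> stem_eq \<Omega> G F"
  by (simp add: stem_eq_def eq_commute)

lemma stem_eq_trans: "stem_eq \<Omega> F G \<Longrightarrow> stem_eq \<Omega> G H \<Longrightarrow> stem_eq \<Omega> F H"
  unfolding stem_eq_def by (auto elim: eventually_elim2)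

lemma symmetric_stem_analytic_cnj:
  assumes "f analytic_on {z}" "\<And>w. f (cnj w) = cnj (f w)"
  shows "f analytic_on {cnj z}"
proof -
  obtain S where S: "open S" "z \<in> S" "f holomorphic_on S"
    using assms(1) by (auto simp: analytic_at)
  have "open (cnj -` S)"
    using S by (intro open_vimage continuous_intros)
  moreover have "cnj ` (cnj -` S) \<subseteq> S"
    by auto
  ultimately have "cnj \<circ> f \<circ> cnj holomorphic_on cnj -` S"
    using S by (intro holomorphic_on_compose_cnj_cnj holomorphic_on_subset[OF S(3)])
  moreover have "cnj \<circ> f \<circ> cnj = f"
    by (auto simp: assms(2))
  ultimately show ?thesis
    using S \<open>open (cnj -` S)\<close> by (auto simp: analytic_at intro!: exI[of _ "cnj -` S"])
qed

lemma open_eventually_at: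
  fixes P :: "'a :: t1_space \<Rightarrow> bool"
  shows "open {z. eventually P (at z)}"
proof (subst open_subopen, intro ballI)
  fix z assume "z \<in> {z. eventually P (at z)}"
  then obtain S where S: "open S" "z \<in> S" "\<And>w. w \<in> S \<Longrightarrow> w \<noteq> z \<Longrightarrow> P w"
    by (auto simp: eventually_at_topological)
  have "eventually P (at w)" if "w \<in> S" for w
  proof (cases "w = z")
    case True
    then show ?thesis using S by (auto simp: eventually_at_topological)
  next
    case False
    then show ?thesis
      using S that unfolding eventually_at_topological
      by (intro exI[of _ "S - {z}"]) (auto simp: open_delete)
  qed
  then show "\<exists>T. open T \<and> z \<in> T \<and> T \<subseteq> {z. eventually P (at z)}"
    using S by blast
qed

lemma open_analytic_at: "open {z. f analytic_on {z}}"
proof (subst open_subopen, intro ballI)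
  fix z assume "z \<in> {z. f analytic_on {z}}"
  then obtain S where "open S" "z \<in> S" "f holomorphic_on S"
    by (auto simp: analytic_at)
  then show "\<exists>T. open T \<and> z \<in> T \<and> T \<subseteq> {z. f analytic_on {z}}"
    by (intro exI[of _ S]) (auto simp: analytic_at)
qed

lemma symmetric_stem_coord:
  "symmetric_stem F \<Longrightarrow> c \<in> bq_coords \<Longrightarrow> c (F (cnj z)) = cnj (c (F z))"
  by (auto simp: symmetric_stem_def bq_coords_def)

lemma finite_bq_coords [simp]: "finite bq_coords"
  by (simp add: bq_coords_def)

lemma biquat_eqI: "(\<And>c. c \<in> bq_coords \<Longrightarrow> c a = c b) \<Longrightarrow> a = b"
  by (simp add: bq_coords_def biquat_eq_iff)

locale circular_open =
  fixes \<Omega> :: "quat set"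
  assumes open_\<Omega>: "open \<Omega>" and circular_\<Omega>: "circular \<Omega>"
begin

abbreviation "D \<equiv> section_of \<Omega>"

lemma open_D: "open D"
  using open_\<Omega> by (rule open_section_of)

lemmas reps_iff = semiregular_reps_iff[OF open_\<Omega> circular_\<Omega>]

lemma stem_in_stems: "(A, f) \<in> semiregular_reps \<Omega> \<Longrightarrow> stem f \<in> stems \<Omega>"
  by (simp add: reps_iff stems_def symmetric_stem_stem)

text \<open>
  Every meromorphic symmetric stem comes from a function, namely the induced one on the set of points
  where all coordinates are analytic.
\<close>

lemma rep_of_stem:
  assumes "F \<in> stems \<Omega>"
  obtains A f where "(A, f) \<in> semiregular_reps \<Omega>" "stem f = F"
proof -
  have F: "symmetric_stem F" "mero_stem_on F D"
    using assms by (simp_all add: stems_def)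
  define E where "E = D \<inter> (\<Inter>c\<in>bq_coords. {z. (\<lambda>w. c (F w)) analytic_on {z}})"
  define A where "A = qcoord -` E"
  have E: "open E" "E \<subseteq> D"
    using open_D by (auto simp: E_def intro!: open_Int open_INT open_analytic_at)
  have E_cnj: "cnj z \<in> E" if "z \<in> E" for z
    using that circular_\<Omega> F(1)
    by (auto simp: E_def intro!: symmetric_stem_analytic_cnj symmetric_stem_coord)
  have A: "open A" "circular A" "section_of A = E"
    using E E_cnj by (auto simp: A_def open_qcoord_vimage circular_qcoord_vimage section_of_qcoord_vimage)
  have "A \<subseteq> \<Omega>"
    using E circular_\<Omega> by (auto simp: A_def circular_mem_iff)
  moreover have "holo_stem_on F E"
    unfolding holo_stem_on_def
  proof
    fix c assume c: "c \<in> bq_coords"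
    have "(\<lambda>z. c (F z)) analytic_on E"
      using c by (subst analytic_on_analytic_at) (auto simp: E_def)
    then show "(\<lambda>z. c (F z)) holomorphic_on E"
      by (rule analytic_imp_holomorphic)
  qed
  moreover have "\<forall>\<^sub>\<approx>z\<in>D. z \<in> E"
  proof -
    have "\<forall>\<^sub>\<approx>z\<in>D. \<forall>c\<in>bq_coords. (\<lambda>w. c (F w)) analytic_on {z}"
      using F(2) by (intro eventually_ball_finite ballI meromorphic_on_imp_analytic_cosparse)
        (auto simp: mero_stem_on_def)
    moreover have "\<forall>\<^sub>\<approx>z\<in>D. z \<in> D"
      using open_D by (intro eventually_in_cosparse) auto
    ultimately show ?thesis
      by eventually_elim (auto simp: E_def)
  qed
  moreover have "stem (induced F) = F"
    using stem_induced[OF F(1)] by blast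
  ultimately have "(A, induced F) \<in> semiregular_reps \<Omega>"
    using A F by (simp add: reps_iff slice_function_on_iff)
  with \<open>stem (induced F) = F\<close> show ?thesis
    using that by blast
qed

text \<open>
  Equality off a sparse set extends to the remaining points by continuity.
\<close>

lemma holo_stem_eq_on:
  assumes "holo_stem_on F E" "holo_stem_on G E" "open E" "E \<subseteq> D" "stem_eq \<Omega> F G" "z \<in> E"
  shows "F z = G z"
proof (rule biquat_eqI)
  fix c assume c: "c \<in> bq_coords"
  have "eventually (\<lambda>w. F w = G w) (at z)"
    using assms open_D by (auto simp: stem_eq_def eventually_cosparse_open_eq)
  then have "eventually (\<lambda>w. c (F w) = c (G w)) (at z)"
    by eventually_elim simp
  moreover have F: "(\<lambda>w. c (F w)) \<midarrow>z\<rightarrow> c (F z)" and G: "(\<lambda>w. c (G w)) \<midarrow>z\<rightarrow> c (G z)"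
    using assms c by (auto intro!: isContD analytic_at_imp_isCont analytic_on_bq_coord)
  ultimately have "(\<lambda>w. c (G w)) \<midarrow>z\<rightarrow> c (F z)"
    by (intro Lim_transform_eventually[OF F])
  then show "c (F z) = c (G z)"
    using G by (rule LIM_unique)
qed

lemma rep_value:
  assumes "(A, f) \<in> semiregular_reps \<Omega>" "q \<in> A"
  shows "f q = bq_Re (stem f (qcoord q)) + qdir q * bq_Im (stem f (qcoord q))"
  using assms by (auto simp: reps_iff slice_function_on_iff induced_def)

text \<open>
  In terms of stems the relation no longer mentions the domains, which shows that it is an equivalence.
\<close>

lemma sem_rel_iff:
  "((A, f), (B, g)) \<in> sem_rel \<Omega> \<longleftrightarrow>
    (A, f) \<in> semiregular_reps \<Omega> \<and> (B, g) \<in> semiregular_reps \<Omega> \<and> stem_eq \<Omega> (stem f) (stem g)"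
proof -
  have "(\<forall>q\<in>A \<inter> B. f q = g q) \<longleftrightarrow> stem_eq \<Omega> (stem f) (stem g)"
    if f: "(A, f) \<in> semiregular_reps \<Omega>" and g: "(B, g) \<in> semiregular_reps \<Omega>"
  proof
    assume eq: "\<forall>q\<in>A \<inter> B. f q = g q"
    have "\<forall>\<^sub>\<approx>z\<in>D. z \<in> section_of A" "\<forall>\<^sub>\<approx>z\<in>D. z \<in> section_of B"
      using f g by (simp_all add: reps_iff)
    then show "stem_eq \<Omega> (stem f) (stem g)"
      unfolding stem_eq_def
    proof eventually_elim
      case (elim z)
      moreover have "cnj z \<in> section_of A" "cnj z \<in> section_of B"
        using elim f g by (simp_all add: reps_iff)
      ultimately show ?case
        using eq by (simp add: stem_def section_of_def)
    qed
  next
    assume eq: "stem_eq \<Omega> (stem f) (stem g)"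
    show "\<forall>q\<in>A \<inter> B. f q = g q"
    proof
      fix q assume q: "q \<in> A \<inter> B"
      have "section_of (A \<inter> B) \<subseteq> section_of A" "section_of (A \<inter> B) \<subseteq> section_of B"
        by auto
      then have "holo_stem_on (stem f) (section_of (A \<inter> B))" "holo_stem_on (stem g) (section_of (A \<inter> B))"
        using f g unfolding reps_iff holo_stem_on_def by (blast intro: holomorphic_on_subset)+
      moreover have "A \<inter> B \<subseteq> \<Omega>" "open (A \<inter> B)" "qcoord q \<in> section_of (A \<inter> B)"
        using f g q by (auto simp: reps_iff circular_mem_iff)
      ultimately have "stem f (qcoord q) = stem g (qcoord q)"
        using eq by (intro holo_stem_eq_on[of _ "section_of (A \<inter> B)"] open_section_of section_of_mono)
      then show "f q = g q"
        using rep_value[OF f] rep_value[OF g] q by simp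
    qed
  qed
  then show ?thesis
    by (auto simp: sem_rel_def)
qed

lemma sem_rel_Image:
  assumes "(A, f) \<in> semiregular_reps \<Omega>"
  shows "sem_rel \<Omega> `` {(A, f)} = stem_class \<Omega> (stem f)"
  using assms by (auto simp: stem_class_def sem_rel_iff stem_eq_sym)

lemma stem_class_cong: "stem_eq \<Omega> F G \<Longrightarrow> stem_class \<Omega> F = stem_class \<Omega> G"
  unfolding stem_class_def by (blast intro: stem_eq_trans stem_eq_sym)

lemma rep_of_class:
  assumes "F \<in> stems \<Omega>"
  obtains A f where "(A, f) \<in> stem_class \<Omega> F"
proof -
  obtain A f where "(A, f) \<in> semiregular_reps \<Omega>" "stem f = F"
    using rep_of_stem[OF assms] .
  then show ?thesis
    by (intro that[of A f]) (simp add: stem_class_def)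
qed

lemma stem_class_eq_iff:
  assumes "F \<in> stems \<Omega>" "G \<in> stems \<Omega>"
  shows "stem_class \<Omega> F = stem_class \<Omega> G \<longleftrightarrow> stem_eq \<Omega> F G"
proof
  assume eq: "stem_class \<Omega> F = stem_class \<Omega> G"
  obtain A f where f: "(A, f) \<in> stem_class \<Omega> F"
    using rep_of_class[OF assms(1)] .
  then have "stem_eq \<Omega> (stem f) F" "stem_eq \<Omega> (stem f) G"
    using eq by (auto simp: stem_class_def)
  then show "stem_eq \<Omega> F G"
    using stem_eq_trans stem_eq_sym by blast
qed (rule stem_class_cong)

lemma carrier_SEM: "carrier (SEM \<Omega>) = stem_class \<Omega> ` stems \<Omega>"
proof
  show "carrier (SEM \<Omega>) \<subseteq> stem_class \<Omega> ` stems \<Omega>"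
    by (auto simp: SEM_def quotient_def sem_rel_Image stem_in_stems)
  show "stem_class \<Omega> ` stems \<Omega> \<subseteq> carrier (SEM \<Omega>)"
  proof
    fix X assume "X \<in> stem_class \<Omega> ` stems \<Omega>"
    then obtain F where F: "F \<in> stems \<Omega>" "X = stem_class \<Omega> F" by blast
    obtain A f where f: "(A, f) \<in> semiregular_reps \<Omega>" "stem f = F"
      using rep_of_stem[OF F(1)] .
    then have "X = sem_rel \<Omega> `` {(A, f)}"
      using F by (simp add: sem_rel_Image)
    then show "X \<in> carrier (SEM \<Omega>)"
      using f(1) by (auto simp: SEM_def quotient_def)
  qed
qed

text \<open>
  The operations on classes are unions over all representatives. They are determined by any choice of
  representatives once the class of the result does not depend on it.
\<close>

lemma Union_classes_eq:
  assumes "F \<in> stems \<Omega>" "G \<in> stems \<Omega>"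
    and "\<And>A f B g. (A, f) \<in> stem_class \<Omega> F \<Longrightarrow> (B, g) \<in> stem_class \<Omega> G \<Longrightarrow>
      sem_rel \<Omega> `` {(A \<inter> B, op f g)} = Z"
  shows "(\<Union>(A, f)\<in>stem_class \<Omega> F. \<Union>(B, g)\<in>stem_class \<Omega> G. sem_rel \<Omega> `` {(A \<inter> B, op f g)}) = Z"
proof -
  obtain A f where f: "(A, f) \<in> stem_class \<Omega> F"
    using rep_of_class[OF assms(1)] .
  obtain B g where g: "(B, g) \<in> stem_class \<Omega> G"
    using rep_of_class[OF assms(2)] .
  have inner: "(\<Union>(B, g)\<in>stem_class \<Omega> G. sem_rel \<Omega> `` {(A \<inter> B, op f g)}) = Z"
    if "(A, f) \<in> stem_class \<Omega> F" for A f
  proof -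
    have "(\<Union>(B, g)\<in>stem_class \<Omega> G. sem_rel \<Omega> `` {(A \<inter> B, op f g)}) = (\<Union>_\<in>stem_class \<Omega> G. Z)"
      by (intro SUP_cong refl) (clarsimp simp: assms(3)[OF that])
    then show ?thesis
      using g by auto
  qed
  have "(\<Union>(A, f)\<in>stem_class \<Omega> F. \<Union>(B, g)\<in>stem_class \<Omega> G. sem_rel \<Omega> `` {(A \<inter> B, op f g)})
      = (\<Union>_\<in>stem_class \<Omega> F. Z)"
    by (intro SUP_cong refl) (clarsimp simp: inner)
  then show ?thesis
    using f by auto
qed

text \<open>
  Common to addition and multiplication: an operation that acts pointwise on stems respects
  holomorphy, meromorphy and equality off sparse sets, and hence passes to classes.
\<close>

lemma pointwise_op_rep:
  assumes f: "(A, f) \<in> stem_class \<Omega> F" and g: "(B, g) \<in> stem_class \<Omega> G"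
    and slice: "slice_function_on h (A \<inter> B)"
    and stem: "\<And>z. z \<in> section_of A \<Longrightarrow> z \<in> section_of B \<Longrightarrow> stem h z = bop (stem f z) (stem g z)"
    and holo: "\<And>F G E. holo_stem_on F E \<Longrightarrow> holo_stem_on G E \<Longrightarrow> holo_stem_on (\<lambda>z. bop (F z) (G z)) E"
    and mero: "\<And>F G E. mero_stem_on F E \<Longrightarrow> mero_stem_on G E \<Longrightarrow> mero_stem_on (\<lambda>z. bop (F z) (G z)) E"
  shows "sem_rel \<Omega> `` {(A \<inter> B, h)} = stem_class \<Omega> (\<lambda>z. bop (F z) (G z))"
proof -
  have fr: "(A, f) \<in> semiregular_reps \<Omega>" "stem_eq \<Omega> (stem f) F"
    and gr: "(B, g) \<in> semiregular_reps \<Omega>" "stem_eq \<Omega> (stem g) G"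
    using f g by (auto simp: stem_class_def)
  have A: "A \<subseteq> \<Omega>" "open A" "circular A" and B: "open B" "circular B"
    using fr gr by (auto simp: reps_iff)
  have evA: "\<forall>\<^sub>\<approx>z\<in>D. z \<in> section_of A" and evB: "\<forall>\<^sub>\<approx>z\<in>D. z \<in> section_of B"
    using fr gr by (simp_all add: reps_iff)
  have eq: "\<forall>\<^sub>\<approx>z\<in>D. stem h z = bop (stem f z) (stem g z)"
    using evA evB by eventually_elim (rule stem)
  have sub: "section_of (A \<inter> B) \<subseteq> section_of A" "section_of (A \<inter> B) \<subseteq> section_of B"
    by auto
  then have "holo_stem_on (stem f) (section_of (A \<inter> B))" "holo_stem_on (stem g) (section_of (A \<inter> B))"
    using fr(1) gr(1) unfolding reps_iff holo_stem_on_def by (blast intro: holomorphic_on_subset)+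
  then have "holo_stem_on (\<lambda>z. bop (stem f z) (stem g z)) (section_of (A \<inter> B))"
    by (rule holo)
  moreover have "holo_stem_on (stem h) (section_of (A \<inter> B)) \<longleftrightarrow>
      holo_stem_on (\<lambda>z. bop (stem f z) (stem g z)) (section_of (A \<inter> B))"
    unfolding holo_stem_on_def by (intro ball_cong refl holomorphic_cong) (auto simp: stem)
  moreover have "mero_stem_on (\<lambda>z. bop (stem f z) (stem g z)) D"
    using fr(1) gr(1) by (intro mero) (simp_all add: reps_iff)
  moreover have "mero_stem_on (stem h) D \<longleftrightarrow> mero_stem_on (\<lambda>z. bop (stem f z) (stem g z)) D"
    unfolding mero_stem_on_def using eq
    by (intro ball_cong refl meromorphic_on_cong') (auto elim: eventually_mono)
  moreover have "\<forall>\<^sub>\<approx>z\<in>D. z \<in> section_of (A \<inter> B)"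
    using evA evB by eventually_elim simp
  ultimately have "(A \<inter> B, h) \<in> semiregular_reps \<Omega>"
    using A B slice by (auto simp: reps_iff circular_Int)
  moreover have "stem_eq \<Omega> (stem h) (\<lambda>z. bop (F z) (G z))"
    using eq fr(2) gr(2) unfolding stem_eq_def by eventually_elim simp
  ultimately show ?thesis
    by (simp add: sem_rel_Image stem_class_cong)
qed

lemma holo_stem_add:
  "holo_stem_on F E \<Longrightarrow> holo_stem_on G E \<Longrightarrow> holo_stem_on (\<lambda>z. F z + G z) E"
  by (auto simp: holo_stem_on_def bq_coords_def intro!: holomorphic_intros)

lemma holo_stem_mult:
  "holo_stem_on F E \<Longrightarrow> holo_stem_on G E \<Longrightarrow> holo_stem_on (\<lambda>z. F z * G z) E"
  by (auto simp: holo_stem_on_def bq_coords_def intro!: holomorphic_intros)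

lemma mero_stem_add:
  "mero_stem_on F E \<Longrightarrow> mero_stem_on G E \<Longrightarrow> mero_stem_on (\<lambda>z. F z + G z) E"
  by (auto simp: mero_stem_on_def bq_coords_def intro!: meromorphic_intros)

lemma mero_stem_mult:
  "mero_stem_on F E \<Longrightarrow> mero_stem_on G E \<Longrightarrow> mero_stem_on (\<lambda>z. F z * G z) E"
  by (auto simp: mero_stem_on_def bq_coords_def intro!: meromorphic_intros)

lemma stems_closed:
  "F \<in> stems \<Omega> \<Longrightarrow> G \<in> stems \<Omega> \<Longrightarrow> (\<lambda>z. F z + G z) \<in> stems \<Omega>"
  "F \<in> stems \<Omega> \<Longrightarrow> G \<in> stems \<Omega> \<Longrightarrow> (\<lambda>z. F z * G z) \<in> stems \<Omega>"
  "F \<in> stems \<Omega> \<Longrightarrow> (\<lambda>z. - F z) \<in> stems \<Omega>"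
  "F \<in> stems \<Omega> \<Longrightarrow> (\<lambda>z. bq_conj (F z)) \<in> stems \<Omega>"
  "(\<lambda>z. bq_pair q 0) \<in> stems \<Omega>"
  "F \<in> stems \<Omega> \<Longrightarrow> (\<lambda>z. bq_scalar (bq_norm (F z))) \<in> stems \<Omega>"
  "F \<in> stems \<Omega> \<Longrightarrow> (\<lambda>z. bq_inv (F z)) \<in> stems \<Omega>"
  by (auto simp: stems_def symmetric_stem_def mero_stem_on_def bq_coords_def bq_norm_def bq_inv_def
      intro!: meromorphic_intros)

lemma stems_coord: "F \<in> stems \<Omega> \<Longrightarrow> c \<in> bq_coords \<Longrightarrow> (\<lambda>z. bq_scalar (c (F z))) \<in> stems \<Omega>"
  by (auto simp: stems_def symmetric_stem_def mero_stem_on_def bq_coords_def)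

lemma add_SEM:
  assumes "F \<in> stems \<Omega>" "G \<in> stems \<Omega>"
  shows "stem_class \<Omega> F \<oplus>\<^bsub>SEM \<Omega>\<^esub> stem_class \<Omega> G = stem_class \<Omega> (\<lambda>z. F z + G z)"
proof -
  have "(\<Union>(A, f)\<in>stem_class \<Omega> F. \<Union>(B, g)\<in>stem_class \<Omega> G. sem_rel \<Omega> `` {(A \<inter> B, \<lambda>q. f q + g q)})
      = stem_class \<Omega> (\<lambda>z. F z + G z)"
  proof (rule Union_classes_eq[OF assms, where op = "\<lambda>f g q. f q + g q"])
    fix A f B g assume f: "(A, f) \<in> stem_class \<Omega> F" and g: "(B, g) \<in> stem_class \<Omega> G"
    then have r: "(A, f) \<in> semiregular_reps \<Omega>" "(B, g) \<in> semiregular_reps \<Omega>"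
      by (auto simp: stem_class_def)
    then have "circular (A \<inter> B)"
      by (simp add: reps_iff circular_Int)
    then have "slice_function_on (\<lambda>q. f q + g q) (A \<inter> B)"
      using rep_value[OF r(1)] rep_value[OF r(2)]
      by (auto simp: slice_function_on_iff induced_def stem_add distrib_left)
    then show "sem_rel \<Omega> `` {(A \<inter> B, \<lambda>q. f q + g q)} = stem_class \<Omega> (\<lambda>z. F z + G z)"
      by (intro pointwise_op_rep[OF f g] holo_stem_add mero_stem_add) (simp_all add: stem_add)
  qed
  then show ?thesis
    by (simp add: SEM_def sem_add_def)
qed

lemma mult_SEM:
  assumes "F \<in> stems \<Omega>" "G \<in> stems \<Omega>"
  shows "stem_class \<Omega> F \<otimes>\<^bsub>SEM \<Omega>\<^esub> stem_class \<Omega> G = stem_class \<Omega> (\<lambda>z. F z * G z)"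
proof -
  have "(\<Union>(A, f)\<in>stem_class \<Omega> F. \<Union>(B, g)\<in>stem_class \<Omega> G. sem_rel \<Omega> `` {(A \<inter> B, star_fun f g)})
      = stem_class \<Omega> (\<lambda>z. F z * G z)"
  proof (rule Union_classes_eq[OF assms])
    fix A f B g assume f: "(A, f) \<in> stem_class \<Omega> F" and g: "(B, g) \<in> stem_class \<Omega> G"
    then have r: "circular A" "circular B" "slice_function_on f A" "slice_function_on g B"
      by (auto simp: stem_class_def reps_iff)
    show "sem_rel \<Omega> `` {(A \<inter> B, star_fun f g)} = stem_class \<Omega> (\<lambda>z. F z * G z)"
      by (intro pointwise_op_rep[OF f g] holo_stem_mult mero_stem_mult
          slice_function_on_star_fun[OF r] stem_star_fun[OF r])
  qed
  then show ?thesis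
    by (simp add: SEM_def sem_star_def)
qed

lemma sem_const_eq: "sem_const \<Omega> q = stem_class \<Omega> (\<lambda>z. bq_pair q 0)"
proof -
  have st: "stem (\<lambda>_. q) = (\<lambda>z. bq_pair q 0)"
    by (auto simp: stem_const)
  have "mero_stem_on (\<lambda>z. bq_pair q 0) D"
    using stems_closed(5) by (simp add: stems_def)
  moreover have "holo_stem_on (\<lambda>z. bq_pair q 0) D"
    by (simp add: holo_stem_on_def bq_coords_def)
  moreover have "\<forall>\<^sub>\<approx>z\<in>D. z \<in> D"
    using open_D by (intro eventually_in_cosparse) auto
  ultimately have "(\<Omega>, \<lambda>_. q) \<in> semiregular_reps \<Omega>"
    using open_\<Omega> circular_\<Omega>
    by (simp add: reps_iff st slice_function_on_iff induced_def)
  then show ?thesis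
    by (simp add: sem_const_def sem_rel_Image st)
qed

lemma zero_SEM: "\<zero>\<^bsub>SEM \<Omega>\<^esub> = stem_class \<Omega> (\<lambda>z. 0)"
  and one_SEM: "\<one>\<^bsub>SEM \<Omega>\<^esub> = stem_class \<Omega> (\<lambda>z. 1)"
proof -
  have "bq_pair 0 0 = 0" "bq_pair 1 0 = 1"
    by (simp_all add: biquat_eq_iff complex_eq_iff)
  then show "\<zero>\<^bsub>SEM \<Omega>\<^esub> = stem_class \<Omega> (\<lambda>z. 0)" "\<one>\<^bsub>SEM \<Omega>\<^esub> = stem_class \<Omega> (\<lambda>z. 1)"
    by (simp_all add: SEM_def sem_const_eq)
qed

lemma stems_const [simp]: "(\<lambda>z. 0) \<in> stems \<Omega>" "(\<lambda>z. 1) \<in> stems \<Omega>"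
  by (auto simp: stems_def symmetric_stem_def mero_stem_on_def bq_coords_def)

lemma ring_SEM: "ring (SEM \<Omega>)"
proof (rule ringI)
  show "abelian_group (SEM \<Omega>)"
  proof (rule abelian_groupI)
    fix X assume "X \<in> carrier (SEM \<Omega>)"
    then obtain F where F: "F \<in> stems \<Omega>" "X = stem_class \<Omega> F"
      by (auto simp: carrier_SEM)
    then have "stem_class \<Omega> (\<lambda>z. - F z) \<oplus>\<^bsub>SEM \<Omega>\<^esub> X = \<zero>\<^bsub>SEM \<Omega>\<^esub>"
      by (simp add: add_SEM stems_closed zero_SEM)
    then show "\<exists>Y\<in>carrier (SEM \<Omega>). Y \<oplus>\<^bsub>SEM \<Omega>\<^esub> X = \<zero>\<^bsub>SEM \<Omega>\<^esub>"
      using F by (auto simp: carrier_SEM stems_closed)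
  qed (auto simp: carrier_SEM add_SEM zero_SEM stems_closed algebra_simps)
  show "monoid (SEM \<Omega>)"
    by (rule monoidI) (auto simp: carrier_SEM mult_SEM one_SEM stems_closed mult.assoc)
qed (auto simp: carrier_SEM add_SEM mult_SEM stems_closed algebra_simps)

lemma minus_SEM:
  assumes "F \<in> stems \<Omega>" "G \<in> stems \<Omega>"
  shows "stem_class \<Omega> F \<ominus>\<^bsub>SEM \<Omega>\<^esub> stem_class \<Omega> G = stem_class \<Omega> (\<lambda>z. F z - G z)"
proof -
  interpret ring "SEM \<Omega>" by (rule ring_SEM)
  have "stem_class \<Omega> (\<lambda>z. - G z) = \<ominus>\<^bsub>SEM \<Omega>\<^esub> stem_class \<Omega> G"
    using assms by (intro minus_equality[symmetric])
      (auto simp: carrier_SEM add_SEM zero_SEM stems_closed)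
  then have "stem_class \<Omega> F \<ominus>\<^bsub>SEM \<Omega>\<^esub> stem_class \<Omega> G
      = stem_class \<Omega> F \<oplus>\<^bsub>SEM \<Omega>\<^esub> stem_class \<Omega> (\<lambda>z. - G z)"
    by (simp only: a_minus_def)
  also have "\<dots> = stem_class \<Omega> (\<lambda>z. F z + - G z)"
    by (intro add_SEM stems_closed assms)
  finally show ?thesis
    by simp
qed

lemma inv_SEM:
  assumes "F \<in> stems \<Omega>" "G \<in> stems \<Omega>" "\<forall>\<^sub>\<approx>z\<in>D. F z * G z = 1" "\<forall>\<^sub>\<approx>z\<in>D. G z * F z = 1"
  shows "inv\<^bsub>SEM \<Omega>\<^esub> stem_class \<Omega> F = stem_class \<Omega> G" "stem_class \<Omega> F \<in> Units (SEM \<Omega>)"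
proof -
  interpret ring "SEM \<Omega>" by (rule ring_SEM)
  have 1: "stem_class \<Omega> F \<otimes>\<^bsub>SEM \<Omega>\<^esub> stem_class \<Omega> G = \<one>\<^bsub>SEM \<Omega>\<^esub>"
    "stem_class \<Omega> G \<otimes>\<^bsub>SEM \<Omega>\<^esub> stem_class \<Omega> F = \<one>\<^bsub>SEM \<Omega>\<^esub>"
    using assms by (auto simp: mult_SEM one_SEM stem_eq_def intro!: stem_class_cong)
  have 2: "stem_class \<Omega> F \<in> carrier (SEM \<Omega>)" "stem_class \<Omega> G \<in> carrier (SEM \<Omega>)"
    using assms by (auto simp: carrier_SEM)
  show "inv\<^bsub>SEM \<Omega>\<^esub> stem_class \<Omega> F = stem_class \<Omega> G"
    using inv_unique'[OF 2 1] by simp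
  show "stem_class \<Omega> F \<in> Units (SEM \<Omega>)"
    using 1 2 by (auto simp: Units_def)
qed

text \<open>
  If \<open>f\<close> preserves every slice, then so do both components of its stem; the slices of \<open>quat_i\<close> and
  \<open>quat_j\<close> meet only in the real numbers, so these components are real and the stem is scalar.
\<close>

lemma SEM_R_iff:
  assumes "F \<in> stems \<Omega>"
  shows "stem_class \<Omega> F \<in> SEM_R \<Omega> \<longleftrightarrow> stem_eq \<Omega> F (\<lambda>z. bq_scalar (bq0 (F z)))"
proof -
  have slice: "slice_preserving_on f A \<longleftrightarrow> stem_eq \<Omega> F (\<lambda>z. bq_scalar (bq0 (F z)))"
    if f: "(A, f) \<in> stem_class \<Omega> F" for A f
  proof -
    have r: "(A, f) \<in> semiregular_reps \<Omega>" "stem_eq \<Omega> (stem f) F"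
      using f by (auto simp: stem_class_def)
    have A: "circular A" "open A" "A \<subseteq> \<Omega>"
      using r by (auto simp: reps_iff)
    have val: "f (slice_point I z) = bq_Re (stem f z) + I * bq_Im (stem f z)"
      if "z \<in> section_of A" "I \<in> imag_units" for z I
      using that r(1) A circular_slice_point_iff[of A I z]
      by (simp add: reps_iff slice_function_on_iff induced_stem_slice_point)
    show ?thesis
    proof
      assume sp: "slice_preserving_on f A"
      have scalar: "stem f z = bq_scalar (bq0 (stem f z))" if z: "z \<in> section_of A" for z
      proof -
        have in_plane: "bq_Re (stem f z) + I * bq_Im (stem f z) \<in> slice_plane I"
          if I: "I \<in> imag_units" for I
        proof -
          have "slice_point I z \<in> A \<inter> slice_plane I"
            using z I A circular_slice_point_iff[of A I z] by (auto simp: slice_plane_def slice_point_def)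
          then have "f (slice_point I z) \<in> slice_plane I"
            using sp I unfolding slice_preserving_on_def by blast
          then show ?thesis using val[OF z I] by simp
        qed
        have slice_plane_sel: "q \<in> slice_plane quat_i \<Longrightarrow> qim2 q = 0 \<and> qim3 q = 0"
          "q \<in> slice_plane (- quat_i) \<Longrightarrow> qim2 q = 0 \<and> qim3 q = 0"
          "q \<in> slice_plane quat_j \<Longrightarrow> qim1 q = 0 \<and> qim3 q = 0"
          "q \<in> slice_plane (- quat_j) \<Longrightarrow> qim1 q = 0 \<and> qim3 q = 0" for q
          by (auto simp: slice_plane_def)
        \<comment> \<open>the signs \<open>I\<close> and \<open>- I\<close> separate the two components of the stem\<close>
        have units: "quat_i \<in> imag_units" "quat_j \<in> imag_units"
          "- quat_i \<in> imag_units" "- quat_j \<in> imag_units"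
          by (simp_all add: imag_units_iff)
        note in_plane[OF units(1)] in_plane[OF units(2)] in_plane[OF units(3)] in_plane[OF units(4)]
        then show ?thesis
          by (auto dest!: slice_plane_sel simp: biquat_eq_iff complex_eq_iff)
      qed
      have "\<forall>\<^sub>\<approx>z\<in>D. z \<in> section_of A"
        using r by (simp add: reps_iff)
      then show "stem_eq \<Omega> F (\<lambda>z. bq_scalar (bq0 (F z)))"
        using r(2) unfolding stem_eq_def
      proof eventually_elim
        case (elim z)
        then show ?case
          using scalar[of z] by simp
      qed
    next
      assume sc: "stem_eq \<Omega> F (\<lambda>z. bq_scalar (bq0 (F z)))"
      have "stem_eq \<Omega> (stem f) (\<lambda>z. bq_scalar (bq0 (stem f z)))"
        using sc r(2) unfolding stem_eq_def by eventually_elim simp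
      moreover have holo: "holo_stem_on (stem f) (section_of A)"
        using r by (simp add: reps_iff)
      moreover from this have "holo_stem_on (\<lambda>z. bq_scalar (bq0 (stem f z))) (section_of A)"
        by (simp add: holo_stem_on_def bq_coords_def)
      ultimately have eq: "stem f z = bq_scalar (bq0 (stem f z))" if "z \<in> section_of A" for z
        using that A by (intro holo_stem_eq_on[of "stem f" "section_of A"] open_section_of section_of_mono)
      show "slice_preserving_on f A"
        unfolding slice_preserving_on_def
      proof (intro ballI image_subsetI)
        fix I q assume I: "I \<in> imag_units" and q: "q \<in> A \<inter> slice_plane I"
        then obtain x y where "q = of_real x + I * of_real y"
          by (auto simp: slice_plane_def)
        then have z: "q = slice_point I (Complex x y)"
          by (simp add: slice_point_def)
        define z where "z = Complex x y"
        note z = z[folded z_def]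
        with q I A have "z \<in> section_of A"
          by (simp add: circular_slice_point_iff)
        then have "f q = bq_Re (bq_scalar (bq0 (stem f z))) + I * bq_Im (bq_scalar (bq0 (stem f z)))"
          using val eq I by (simp add: z)
        moreover have "bq_Re (bq_scalar w) = of_real (Re w)" "bq_Im (bq_scalar w) = of_real (Im w)" for w
          by (simp_all add: quat_eq_iff)
        ultimately show "f q \<in> slice_plane I"
          by (auto simp: slice_plane_def)
      qed
    qed
  qed
  obtain A f where f: "(A, f) \<in> stem_class \<Omega> F"
    using rep_of_class[OF assms] .
  have "stem_class \<Omega> F \<in> carrier (SEM \<Omega>)"
    using assms by (simp add: carrier_SEM)
  then have "stem_class \<Omega> F \<in> SEM_R \<Omega> \<longleftrightarrow> (\<exists>(A, f)\<in>stem_class \<Omega> F. slice_preserving_on f A)"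
    by (simp add: SEM_R_def)
  also have "\<dots> \<longleftrightarrow> stem_eq \<Omega> F (\<lambda>z. bq_scalar (bq0 (F z)))"
  proof
    assume "\<exists>(A, f)\<in>stem_class \<Omega> F. slice_preserving_on f A"
    then obtain A' f' where "(A', f') \<in> stem_class \<Omega> F" "slice_preserving_on f' A'"
      by auto
    then show "stem_eq \<Omega> F (\<lambda>z. bq_scalar (bq0 (F z)))"
      by (simp only: slice)
  next
    assume "stem_eq \<Omega> F (\<lambda>z. bq_scalar (bq0 (F z)))"
    then have "slice_preserving_on f A"
      using slice[OF f] by simp
    then show "\<exists>(A, f)\<in>stem_class \<Omega> F. slice_preserving_on f A"
      by (intro bexI[OF _ f]) simp
  qed
  finally show ?thesis .
qed

end

lemma bq_pair_units [simp]:
  "bq_pair quat_i 0 = bq_i" "bq_pair quat_j 0 = bq_j" "bq_pair quat_k 0 = bq_k" "bq_pair 1 0 = 1"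
  by (simp_all add: biquat_eq_iff complex_eq_iff)

section \<open>Conjugate, norm and inverse\<close>

context circular_open
begin

lemma stems_bq_units [simp]: "(\<lambda>z. bq_i) \<in> stems \<Omega>" "(\<lambda>z. bq_j) \<in> stems \<Omega>" "(\<lambda>z. bq_k) \<in> stems \<Omega>"
  using stems_closed(5)[of quat_i] stems_closed(5)[of quat_j] stems_closed(5)[of quat_k] by simp_all

lemma stems_scalar_coords [simp]:
  assumes "F \<in> stems \<Omega>"
  shows "(\<lambda>z. bq_scalar (bq0 (F z))) \<in> stems \<Omega>" "(\<lambda>z. bq_scalar (bq1 (F z))) \<in> stems \<Omega>"
    "(\<lambda>z. bq_scalar (bq2 (F z))) \<in> stems \<Omega>" "(\<lambda>z. bq_scalar (bq3 (F z))) \<in> stems \<Omega>"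
  by (rule stems_coord[OF assms], simp add: bq_coords_def)+

lemma basis_combination_SEM:
  assumes "F0 \<in> stems \<Omega>" "F1 \<in> stems \<Omega>" "F2 \<in> stems \<Omega>" "F3 \<in> stems \<Omega>"
  shows "stem_class \<Omega> F1 \<otimes>\<^bsub>SEM \<Omega>\<^esub> sem_const \<Omega> quat_i \<oplus>\<^bsub>SEM \<Omega>\<^esub>
      stem_class \<Omega> F2 \<otimes>\<^bsub>SEM \<Omega>\<^esub> sem_const \<Omega> quat_j \<oplus>\<^bsub>SEM \<Omega>\<^esub>
      stem_class \<Omega> F3 \<otimes>\<^bsub>SEM \<Omega>\<^esub> sem_const \<Omega> quat_k
    = stem_class \<Omega> (\<lambda>z. F1 z * bq_i + F2 z * bq_j + F3 z * bq_k)"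
  using assms by (simp add: sem_const_eq mult_SEM add_SEM stems_closed)

text \<open>
  The coordinates of a semi-regular function are the complex coordinates of its stem. Uniqueness
  follows by comparing biquaternion coordinates pointwise.
\<close>

lemma sem_coords_stem:
  assumes F: "F \<in> stems \<Omega>"
  shows "sem_coords \<Omega> (stem_class \<Omega> F) =
    (stem_class \<Omega> (\<lambda>z. bq_scalar (bq0 (F z))), stem_class \<Omega> (\<lambda>z. bq_scalar (bq1 (F z))),
     stem_class \<Omega> (\<lambda>z. bq_scalar (bq2 (F z))), stem_class \<Omega> (\<lambda>z. bq_scalar (bq3 (F z))))"
  unfolding sem_coords_def
proof (rule the_equality, goal_cases)
  case 1
  have "stem_class \<Omega> F = stem_class \<Omega> (\<lambda>z. bq_scalar (bq0 (F z)) +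
      (bq_scalar (bq1 (F z)) * bq_i + bq_scalar (bq2 (F z)) * bq_j + bq_scalar (bq3 (F z)) * bq_k))"
    by (simp only: bq_scalar_decomp[symmetric])
  then show ?case
    using F by (simp add: SEM_R_iff basis_combination_SEM[OF F] add_SEM stems_closed)
next
  case (2 x)
  obtain X0 X1 X2 X3 where x: "x = (X0, X1, X2, X3)"
    by (cases x) auto
  have scalar_stem: "\<exists>G\<in>stems \<Omega>. X = stem_class \<Omega> G \<and> stem_eq \<Omega> G (\<lambda>z. bq_scalar (bq0 (G z)))"
    if "X \<in> SEM_R \<Omega>" for X
  proof -
    have "X \<in> carrier (SEM \<Omega>)"
      using that by (simp add: SEM_R_def)
    then obtain G where "G \<in> stems \<Omega>" "X = stem_class \<Omega> G"
      by (auto simp: carrier_SEM)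
    then show ?thesis
      using that SEM_R_iff by blast
  qed
  from 2 have mem: "X0 \<in> SEM_R \<Omega>" "X1 \<in> SEM_R \<Omega>" "X2 \<in> SEM_R \<Omega>" "X3 \<in> SEM_R \<Omega>"
    and eq: "stem_class \<Omega> F = X0 \<oplus>\<^bsub>SEM \<Omega>\<^esub> (X1 \<otimes>\<^bsub>SEM \<Omega>\<^esub> sem_const \<Omega> quat_i \<oplus>\<^bsub>SEM \<Omega>\<^esub>
      X2 \<otimes>\<^bsub>SEM \<Omega>\<^esub> sem_const \<Omega> quat_j \<oplus>\<^bsub>SEM \<Omega>\<^esub> X3 \<otimes>\<^bsub>SEM \<Omega>\<^esub> sem_const \<Omega> quat_k)"
    by (simp_all add: x)
  obtain F0 where F0: "F0 \<in> stems \<Omega>" "X0 = stem_class \<Omega> F0" "stem_eq \<Omega> F0 (\<lambda>z. bq_scalar (bq0 (F0 z)))"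
    using scalar_stem[OF mem(1)] by blast
  obtain F1 where F1: "F1 \<in> stems \<Omega>" "X1 = stem_class \<Omega> F1" "stem_eq \<Omega> F1 (\<lambda>z. bq_scalar (bq0 (F1 z)))"
    using scalar_stem[OF mem(2)] by blast
  obtain F2 where F2: "F2 \<in> stems \<Omega>" "X2 = stem_class \<Omega> F2" "stem_eq \<Omega> F2 (\<lambda>z. bq_scalar (bq0 (F2 z)))"
    using scalar_stem[OF mem(3)] by blast
  obtain F3 where F3: "F3 \<in> stems \<Omega>" "X3 = stem_class \<Omega> F3" "stem_eq \<Omega> F3 (\<lambda>z. bq_scalar (bq0 (F3 z)))"
    using scalar_stem[OF mem(4)] by blast
  have "stem_class \<Omega> F = stem_class \<Omega> (\<lambda>z. F0 z + (F1 z * bq_i + F2 z * bq_j + F3 z * bq_k))"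
    using eq F0 F1 F2 F3 by (simp add: basis_combination_SEM add_SEM stems_closed)
  then have "stem_eq \<Omega> F (\<lambda>z. F0 z + (F1 z * bq_i + F2 z * bq_j + F3 z * bq_k))"
    using F F0 F1 F2 F3 by (subst (asm) stem_class_eq_iff) (auto intro!: stems_closed)
  with F0(3) F1(3) F2(3) F3(3) have "\<forall>\<^sub>\<approx>z\<in>D. F0 z = bq_scalar (bq0 (F z)) \<and> F1 z = bq_scalar (bq1 (F z))
      \<and> F2 z = bq_scalar (bq2 (F z)) \<and> F3 z = bq_scalar (bq3 (F z))"
    unfolding stem_eq_def
  proof eventually_elim
    case (elim z)
    obtain x0 x1 x2 x3 where "F0 z = bq_scalar x0" "F1 z = bq_scalar x1" "F2 z = bq_scalar x2" "F3 z = bq_scalar x3"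
      using elim by blast
    then show ?case
      using elim(5) by (simp add: biquat_eq_iff)
  qed
  then show ?case
    unfolding x F0(2) F1(2) F2(2) F3(2) prod.inject
    by (intro conjI stem_class_cong) (auto simp: stem_eq_def elim: eventually_mono)
qed

lemma sem_re_stem: "F \<in> stems \<Omega> \<Longrightarrow> sem_re \<Omega> (stem_class \<Omega> F) = stem_class \<Omega> (\<lambda>z. bq_scalar (bq0 (F z)))"
  by (simp add: sem_re_def sem_coords_stem)

lemma sem_conj_stem:
  assumes "F \<in> stems \<Omega>"
  shows "sem_conj \<Omega> (stem_class \<Omega> F) = stem_class \<Omega> (\<lambda>z. bq_conj (F z))"
proof -
  have "sem_conj \<Omega> (stem_class \<Omega> F) = stem_class \<Omega> (\<lambda>z. bq_scalar (bq0 (F z)) -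
      (bq_scalar (bq1 (F z)) * bq_i + bq_scalar (bq2 (F z)) * bq_j + bq_scalar (bq3 (F z)) * bq_k))"
    using assms by (simp add: sem_conj_def sem_coords_stem basis_combination_SEM[OF assms] minus_SEM stems_closed)
  moreover have "bq_scalar (bq0 a) - (bq_scalar (bq1 a) * bq_i + bq_scalar (bq2 a) * bq_j + bq_scalar (bq3 a) * bq_k)
      = bq_conj a" for a
    by (simp add: biquat_eq_iff)
  ultimately show ?thesis
    by simp
qed

lemma sem_symm_stem:
  "F \<in> stems \<Omega> \<Longrightarrow> sem_symm \<Omega> (stem_class \<Omega> F) = stem_class \<Omega> (\<lambda>z. bq_scalar (bq_norm (F z)))"
  by (simp add: sem_symm_def sem_conj_stem mult_SEM stems_closed bq_mult_conj)

lemma unit_SEM_stem: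
  assumes "F \<in> stems \<Omega>" "\<forall>\<^sub>\<approx>z\<in>D. bq_norm (F z) \<noteq> 0"
  shows "stem_class \<Omega> F \<in> Units (SEM \<Omega>)"
proof (rule inv_SEM(2)[OF assms(1) stems_closed(7)[OF assms(1)]])
  show "\<forall>\<^sub>\<approx>z\<in>D. F z * bq_inv (F z) = 1" "\<forall>\<^sub>\<approx>z\<in>D. bq_inv (F z) * F z = 1"
    using assms(2) by (auto elim!: eventually_mono simp: bq_mult_inv)
qed

lemma sem_inv_stem:
  assumes F: "F \<in> stems \<Omega>" and nz: "\<forall>\<^sub>\<approx>z\<in>D. bq_norm (F z) \<noteq> 0"
  shows "sem_inv \<Omega> (stem_class \<Omega> F) = stem_class \<Omega> (\<lambda>z. bq_inv (F z))"
proof -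
  have rec: "(\<lambda>z. bq_scalar (1 / bq_norm (F z))) \<in> stems \<Omega>"
    using F by (auto simp: stems_def symmetric_stem_def mero_stem_on_def bq_coords_def bq_norm_def
      intro!: meromorphic_intros)
  have "inv\<^bsub>SEM \<Omega>\<^esub> stem_class \<Omega> (\<lambda>z. bq_scalar (bq_norm (F z))) = stem_class \<Omega> (\<lambda>z. bq_scalar (1 / bq_norm (F z)))"
    using nz by (intro inv_SEM(1) stems_closed F rec) (auto elim!: eventually_mono)
  then show ?thesis
    using F rec by (simp add: sem_inv_def sem_symm_stem sem_conj_stem mult_SEM stems_closed bq_inv_def)
qed

lemma sylvester_stem:
  assumes "F \<in> stems \<Omega>" "G \<in> stems \<Omega>" "X \<in> stems \<Omega>"
  shows "sylvester \<Omega> (stem_class \<Omega> F) (stem_class \<Omega> G) (stem_class \<Omega> X)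
    = stem_class \<Omega> (\<lambda>z. F z * X z + X z * G z)"
  using assms by (simp add: sylvester_def mult_SEM add_SEM stems_closed)

lemma double_SEM:
  assumes "F \<in> stems \<Omega>"
  shows "[(2::nat)] \<cdot>\<^bsub>SEM \<Omega>\<^esub> stem_class \<Omega> F = stem_class \<Omega> (\<lambda>z. F z + F z)"
proof -
  interpret ring "SEM \<Omega>" by (rule ring_SEM)
  have "stem_class \<Omega> F \<in> carrier (SEM \<Omega>)"
    using assms by (simp add: carrier_SEM)
  then have "[(2::nat)] \<cdot>\<^bsub>SEM \<Omega>\<^esub> stem_class \<Omega> F = stem_class \<Omega> F \<oplus>\<^bsub>SEM \<Omega>\<^esub> stem_class \<Omega> F"
    by (simp add: numeral_2_eq_2)
  then show ?thesis
    using assms by (simp add: add_SEM)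
qed

end

section \<open>The identity principle\<close>

locale circular_connected = circular_open +
  assumes connected_\<Omega>: "connected \<Omega>"
begin

text \<open>
  The section of \<open>\<Omega>\<close> has two components if \<open>\<Omega>\<close> misses the real axis, so the identity theorem for connected
  plane sets does not apply. Instead, the points with a punctured neighbourhood on which \<open>\<phi>\<close> is identically zero
  and those with one on which it has no zeros form two disjoint open sets, both symmetric; their preimages under \<open>qcoord\<close> separate \<open>\<Omega>\<close>
  unless one of them is empty.
\<close>

lemma symmetric_meromorphic_zero_or_nonzero:
  assumes mero: "\<phi> meromorphic_on D" and sym: "\<And>z. \<phi> (cnj z) = cnj (\<phi> z)"
  shows "(\<forall>\<^sub>\<approx>z\<in>D. \<phi> z = 0) \<or> (\<forall>\<^sub>\<approx>z\<in>D. \<phi> z \<noteq> 0)"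
proof -
  define Z N where "Z = D \<inter> {z. eventually (\<lambda>w. \<phi> w = 0) (at z)}"
    and "N = D \<inter> {z. eventually (\<lambda>w. \<phi> w \<noteq> 0) (at z)}"
  have "open Z" "open N"
    by (auto simp: Z_def N_def intro!: open_Int open_D open_eventually_at)
  moreover have "qcoord -` Z \<inter> qcoord -` N \<inter> \<Omega> = {}"
  proof -
    have False if "eventually (\<lambda>w. \<phi> w = 0) (at z)" "eventually (\<lambda>w. \<phi> w \<noteq> 0) (at z)" for z
    proof -
      have "eventually (\<lambda>w. False) (at z)"
        using that by eventually_elim simp
      then show False by simp
    qed
    then show ?thesis
      by (auto simp: Z_def N_def)
  qed
  moreover have ZN: "D \<subseteq> Z \<union> N"
  proof
    fix z assume z: "z \<in> D"
    then have "isolated_singularity_at \<phi> z" "not_essential \<phi> z"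
      using mero by (simp_all add: meromorphic_on_altdef)
    then have "frequently (\<lambda>w. \<phi> w = 0) (at z) \<Longrightarrow> eventually (\<lambda>w. \<phi> w = 0) (at z)"
      by (rule not_essential_frequently_0_imp_eventually_0)
    then show "z \<in> Z \<union> N"
      using z by (auto simp: Z_def N_def frequently_def)
  qed
  then have "\<Omega> \<subseteq> qcoord -` Z \<union> qcoord -` N"
    using circular_\<Omega> by (auto simp: circular_mem_iff)
  ultimately have sep: "qcoord -` Z \<inter> \<Omega> = {} \<or> qcoord -` N \<inter> \<Omega> = {}"
    by (intro connectedD[OF connected_\<Omega>] open_qcoord_vimage)
  have meets: "\<exists>q\<in>\<Omega>. eventually (\<lambda>w. P (\<phi> w)) (at (qcoord q)) \<and> qcoord q \<in> D"
    if P: "\<And>w. P (cnj w) = P w" and z: "z \<in> D" "eventually (\<lambda>w. P (\<phi> w)) (at z)" for z P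
  proof -
    have "eventually (\<lambda>w. P (\<phi> w)) (at (cnj z))" "cnj z \<in> D"
      using z circular_\<Omega> by (simp_all add: at_cnj[symmetric] eventually_filtermap sym P)
    moreover have "qcoord (slice_point quat_i z) = z \<or> qcoord (slice_point quat_i z) = cnj z"
      by (simp add: qcoord_slice_point_cases)
    moreover have "slice_point quat_i z \<in> \<Omega>"
      using z by (simp add: section_of_def)
    ultimately show ?thesis
      using z by (intro bexI[of _ "slice_point quat_i z"]) auto
  qed
  from sep have "Z = {} \<or> N = {}"
  proof
    assume empty: "qcoord -` Z \<inter> \<Omega> = {}"
    have "z \<notin> Z" for z
    proof
      assume "z \<in> Z"
      then have "\<exists>q\<in>\<Omega>. qcoord q \<in> Z"
        using meets[of "\<lambda>w. w = 0" z] by (simp add: Z_def conj_commute)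
      then show False
        using empty by blast
    qed
    then have "Z = {}"
      by blast
    then show ?thesis ..
  next
    assume empty: "qcoord -` N \<inter> \<Omega> = {}"
    have "z \<notin> N" for z
    proof
      assume "z \<in> N"
      then have "\<exists>q\<in>\<Omega>. qcoord q \<in> N"
        using meets[of "\<lambda>w. w \<noteq> 0" z] by (simp add: N_def conj_commute)
      then show False
        using empty by blast
    qed
    then have "N = {}"
      by blast
    then show ?thesis ..
  qed
  then have "D \<subseteq> Z \<or> D \<subseteq> N"
    using ZN by auto
  then show ?thesis
    using open_D by (auto simp: eventually_cosparse_open_eq Z_def N_def)
qed

lemma norm_zero_or_nonzero:
  assumes "F \<in> stems \<Omega>"
  shows "stem_eq \<Omega> (\<lambda>z. bq_scalar (bq_norm (F z))) (\<lambda>z. 0) \<or> (\<forall>\<^sub>\<approx>z\<in>D. bq_norm (F z) \<noteq> 0)"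
proof -
  have "(\<lambda>z. bq_norm (F z)) meromorphic_on D"
    using assms by (auto simp: stems_def mero_stem_on_def bq_coords_def bq_norm_def intro!: meromorphic_intros)
  moreover have "bq_norm (F (cnj z)) = cnj (bq_norm (F z))" for z
    using assms by (simp add: stems_def symmetric_stem_def)
  ultimately have "(\<forall>\<^sub>\<approx>z\<in>D. bq_norm (F z) = 0) \<or> (\<forall>\<^sub>\<approx>z\<in>D. bq_norm (F z) \<noteq> 0)"
    by (rule symmetric_meromorphic_zero_or_nonzero)
  then show ?thesis
    by (auto simp: stem_eq_def biquat_eq_iff)
qed

lemma norm_nonzero_if_not_zero_divisor:
  assumes F: "F \<in> stems \<Omega>" and "stem_class \<Omega> F \<notin> SEM_R \<Omega>" "\<not> sem_zero_divisor \<Omega> (stem_class \<Omega> F)"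
  shows "\<forall>\<^sub>\<approx>z\<in>D. bq_norm (F z) \<noteq> 0"
proof -
  have "\<zero>\<^bsub>SEM \<Omega>\<^esub> \<in> SEM_R \<Omega>"
    by (simp add: zero_SEM SEM_R_iff)
  then have "sem_symm \<Omega> (stem_class \<Omega> F) \<noteq> \<zero>\<^bsub>SEM \<Omega>\<^esub>"
    using assms by (auto simp: sem_zero_divisor_def carrier_SEM)
  then have "\<not> stem_eq \<Omega> (\<lambda>z. bq_scalar (bq_norm (F z))) (\<lambda>z. 0)"
    using F by (simp add: sem_symm_stem zero_SEM stem_class_eq_iff stems_closed)
  then show ?thesis
    using norm_zero_or_nonzero[OF F] by blast
qed

lemma vector_part_nonzero:
  assumes F: "F \<in> stems \<Omega>" and nR: "stem_class \<Omega> F \<notin> SEM_R \<Omega>"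
  shows "\<forall>\<^sub>\<approx>z\<in>D. bq1 (F z) \<noteq> 0 \<or> bq2 (F z) \<noteq> 0 \<or> bq3 (F z) \<noteq> 0"
proof -
  have alt: "(\<forall>\<^sub>\<approx>z\<in>D. c (F z) = 0) \<or> (\<forall>\<^sub>\<approx>z\<in>D. c (F z) \<noteq> 0)" if "c \<in> bq_coords" for c
    using F that by (intro symmetric_meromorphic_zero_or_nonzero symmetric_stem_coord)
      (auto simp: stems_def mero_stem_on_def)
  have "\<not> ((\<forall>\<^sub>\<approx>z\<in>D. bq1 (F z) = 0) \<and> (\<forall>\<^sub>\<approx>z\<in>D. bq2 (F z) = 0) \<and> (\<forall>\<^sub>\<approx>z\<in>D. bq3 (F z) = 0))"
  proof
    assume "(\<forall>\<^sub>\<approx>z\<in>D. bq1 (F z) = 0) \<and> (\<forall>\<^sub>\<approx>z\<in>D. bq2 (F z) = 0) \<and> (\<forall>\<^sub>\<approx>z\<in>D. bq3 (F z) = 0)"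
    then have "\<forall>\<^sub>\<approx>z\<in>D. bq1 (F z) = 0 \<and> bq2 (F z) = 0 \<and> bq3 (F z) = 0"
      by (intro eventually_conj) blast+
    then have "stem_eq \<Omega> F (\<lambda>z. bq_scalar (bq0 (F z)))"
      unfolding stem_eq_def by eventually_elim (simp add: biquat_eq_iff)
    then show False
      using nR F by (simp add: SEM_R_iff)
  qed
  then consider "\<forall>\<^sub>\<approx>z\<in>D. bq1 (F z) \<noteq> 0" | "\<forall>\<^sub>\<approx>z\<in>D. bq2 (F z) \<noteq> 0" | "\<forall>\<^sub>\<approx>z\<in>D. bq3 (F z) \<noteq> 0"
    using alt[of bq1] alt[of bq2] alt[of bq3] by (auto simp: bq_coords_def)
  then show ?thesis
    by cases (auto elim: eventually_mono)
qed

text \<open>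
  \<open>M * bq_conj M\<close> is the norm of \<open>M\<close>, so the conjugate annihilates \<open>M\<close> on both sides. It is non-zero
  unless \<open>M\<close> is, and in that case \<open>1\<close> does the job.
\<close>

lemma annihilator_if_norm_zero:
  assumes M: "M \<in> stems \<Omega>" and nz: "stem_eq \<Omega> (\<lambda>z. bq_scalar (bq_norm (M z))) (\<lambda>z. 0)"
    and D: "D \<noteq> {}"
  obtains \<eta> where "\<eta> \<in> stems \<Omega>" "\<not> stem_eq \<Omega> \<eta> (\<lambda>z. 0)"
    "stem_eq \<Omega> (\<lambda>z. M z * \<eta> z) (\<lambda>z. 0)" "stem_eq \<Omega> (\<lambda>z. \<eta> z * M z) (\<lambda>z. 0)"
proof (cases "stem_eq \<Omega> M (\<lambda>z. 0)")
  case True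
  have "\<not> stem_eq \<Omega> (\<lambda>z. 1) (\<lambda>z. 0)"
    using D by (simp add: stem_eq_def)
  with True show ?thesis
    by (intro that[of "\<lambda>z. 1"]) simp_all
next
  case False
  have "\<not> stem_eq \<Omega> (\<lambda>z. bq_conj (M z)) (\<lambda>z. 0)"
    using False by (simp add: stem_eq_def biquat_eq_iff)
  with nz M show ?thesis
    by (intro that[of "\<lambda>z. bq_conj (M z)"]) (simp_all add: stems_closed bq_mult_conj bq_conj_mult_self)
qed

end

section \<open>The Sylvester equation\<close>

text \<open>
  The Sylvester operator composed with that of \<open>a\<close> and \<open>bq_conj b\<close> is left multiplication by a polynomial in
  \<open>a\<close>, because \<open>b + bq_conj b\<close> and \<open>b * bq_conj b\<close> are scalars.
\<close>

lemma bq_cayley_hamilton_left: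
  "a * (a * e + e * bq_conj b) + (a * e + e * bq_conj b) * b
    = (a * a + bq_scalar (2 * bq0 b) * a + bq_scalar (bq_norm b)) * e"
proof -
  have "a * (a * e + e * bq_conj b) + (a * e + e * bq_conj b) * b
      = a * a * e + a * e * (b + bq_conj b) + e * (bq_conj b * b)"
    by (simp add: algebra_simps)
  also have "\<dots> = (a * a + bq_scalar (2 * bq0 b) * a + bq_scalar (bq_norm b)) * e"
    unfolding bq_add_conj bq_conj_mult_self bq_scalar_central[of _ "a * e", symmetric]
      bq_scalar_central[of _ e, symmetric]
    by (simp add: distrib_right mult.assoc)
  finally show ?thesis .
qed

lemma bq_cayley_hamilton_right:
  "a * (bq_conj a * e + e * b) + (bq_conj a * e + e * b) * b
    = e * (b * b + bq_scalar (2 * bq0 a) * b + bq_scalar (bq_norm a))"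
proof -
  have "a * (bq_conj a * e + e * b) + (bq_conj a * e + e * b) * b
      = (a * bq_conj a) * e + (a + bq_conj a) * e * b + e * (b * b)"
    by (simp add: algebra_simps)
  also have "\<dots> = e * (b * b + bq_scalar (2 * bq0 a) * b + bq_scalar (bq_norm a))"
    unfolding bq_add_conj bq_mult_conj bq_scalar_central[of _ e]
    by (simp add: distrib_left mult.assoc)
  finally show ?thesis .
qed

text \<open>
  \<open>bq_lambda f g\<close> is \<open>\<lambda>\<^sub>L\<close> and \<open>bq_lambda g f\<close> is \<open>\<lambda>\<^sub>R\<close>, since \<open>\<lambda>\<^sub>R\<close> arises from \<open>\<lambda>\<^sub>L\<close> by exchanging
  the two functions.
\<close>

definition bq_lambda :: "biquat \<Rightarrow> biquat \<Rightarrow> biquat"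
  where "bq_lambda a b = bq_scalar (2 * bq0 b) + a + bq_scalar (bq_norm b) * bq_inv a"

lemma bq_lambda_mult:
  assumes "bq_norm a \<noteq> 0"
  shows "bq_lambda a b * a = a * a + bq_scalar (2 * bq0 b) * a + bq_scalar (bq_norm b)"
  using bq_mult_inv[OF assms] by (simp add: bq_lambda_def distrib_right mult.assoc)

text \<open>
  Multiplying by \<open>bq_inv a\<close> from the left and \<open>bq_conj b\<close> from the right turns \<open>a * x\<close> into \<open>x * bq_conj b\<close> and
  \<open>x * b\<close> into a scalar times \<open>bq_inv a * x\<close>. Thus \<open>x\<close> comes to stand on the right of every term.
\<close>

lemma bq_sylvester_left:
  assumes "bq_norm a \<noteq> 0"
  shows "(a * x + x * b) + bq_inv a * (a * x + x * b) * bq_conj b = bq_lambda a b * x"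
proof -
  have "(a * x + x * b) + bq_inv a * (a * x + x * b) * bq_conj b
      = a * x + x * b + (bq_inv a * a) * x * bq_conj b + bq_inv a * (x * (b * bq_conj b))"
    by (simp add: algebra_simps)
  also have "\<dots> = a * x + x * (b + bq_conj b) + bq_inv a * (x * (b * bq_conj b))"
    using bq_mult_inv(2)[OF assms] by (simp add: algebra_simps)
  also have "\<dots> = bq_lambda a b * x"
    unfolding bq_add_conj bq_mult_conj bq_lambda_def bq_scalar_central[of _ x, symmetric]
      bq_scalar_central[of _ "bq_inv a"]
    by (simp add: algebra_simps)
  finally show ?thesis .
qed

lemma bq_sylvester_right:
  assumes "bq_norm b \<noteq> 0"
  shows "(a * x + x * b) + bq_conj a * (a * x + x * b) * bq_inv b = x * bq_lambda b a"
proof -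
  have "(a * x + x * b) + bq_conj a * (a * x + x * b) * bq_inv b
      = a * x + x * b + (bq_conj a * a) * x * bq_inv b + bq_conj a * x * (b * bq_inv b)"
    by (simp add: algebra_simps)
  also have "\<dots> = (a + bq_conj a) * x + x * b + (bq_conj a * a) * x * bq_inv b"
    using bq_mult_inv(1)[OF assms] by (simp add: algebra_simps)
  also have "\<dots> = x * bq_lambda b a"
    unfolding bq_add_conj bq_conj_mult_self bq_lambda_def bq_scalar_central[of _ x]
    by (simp add: algebra_simps)
  finally show ?thesis .
qed

context circular_connected
begin

lemma lambda_stem:
  assumes F: "F \<in> stems \<Omega>" and G: "G \<in> stems \<Omega>" and nz: "\<forall>\<^sub>\<approx>z\<in>D. bq_norm (F z) \<noteq> 0"
  shows "(\<lambda>z. bq_lambda (F z) (G z)) \<in> stems \<Omega>"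
    "[(2::nat)] \<cdot>\<^bsub>SEM \<Omega>\<^esub> sem_re \<Omega> (stem_class \<Omega> G) \<oplus>\<^bsub>SEM \<Omega>\<^esub> stem_class \<Omega> F \<oplus>\<^bsub>SEM \<Omega>\<^esub>
      sem_symm \<Omega> (stem_class \<Omega> G) \<otimes>\<^bsub>SEM \<Omega>\<^esub> sem_inv \<Omega> (stem_class \<Omega> F)
     = stem_class \<Omega> (\<lambda>z. bq_lambda (F z) (G z))"
proof -
  have eq: "bq_lambda a b = bq_scalar (bq0 b) + bq_scalar (bq0 b) + a + bq_scalar (bq_norm b) * bq_inv a" for a b
    by (simp add: bq_lambda_def)
  show "(\<lambda>z. bq_lambda (F z) (G z)) \<in> stems \<Omega>"
    unfolding eq by (intro stems_closed stems_scalar_coords F G)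
  show "[(2::nat)] \<cdot>\<^bsub>SEM \<Omega>\<^esub> sem_re \<Omega> (stem_class \<Omega> G) \<oplus>\<^bsub>SEM \<Omega>\<^esub> stem_class \<Omega> F \<oplus>\<^bsub>SEM \<Omega>\<^esub>
      sem_symm \<Omega> (stem_class \<Omega> G) \<otimes>\<^bsub>SEM \<Omega>\<^esub> sem_inv \<Omega> (stem_class \<Omega> F)
     = stem_class \<Omega> (\<lambda>z. bq_lambda (F z) (G z))"
    unfolding eq sem_re_stem[OF G] sem_symm_stem[OF G] sem_inv_stem[OF F nz]
      double_SEM[OF stems_scalar_coords(1)[OF G]]
    by (subst mult_SEM add_SEM, (intro stems_closed stems_scalar_coords F G)+)+ (rule refl)
qed

text \<open>
  Both \<open>\<lambda>\<^sub>L\<close> and \<open>\<lambda>\<^sub>R\<close> are non-singular if the corresponding quadratic polynomial has no annihilator. The annihilator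
  is available on both sides, the right one being used for \<open>\<lambda>\<^sub>L\<close> and the left one for \<open>\<lambda>\<^sub>R\<close>.
\<close>

lemma lambda_norm_nonzero:
  assumes F: "F \<in> stems \<Omega>" and G: "G \<in> stems \<Omega>" and nz: "\<forall>\<^sub>\<approx>z\<in>D. bq_norm (F z) \<noteq> 0"
    and no_annihilator: "\<And>\<eta>. \<eta> \<in> stems \<Omega> \<Longrightarrow>
      stem_eq \<Omega> (\<lambda>z. (F z * F z + bq_scalar (2 * bq0 (G z)) * F z + bq_scalar (bq_norm (G z))) * \<eta> z) (\<lambda>z. 0) \<Longrightarrow>
      stem_eq \<Omega> (\<lambda>z. \<eta> z * (F z * F z + bq_scalar (2 * bq0 (G z)) * F z + bq_scalar (bq_norm (G z)))) (\<lambda>z. 0) \<Longrightarrow>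
      stem_eq \<Omega> \<eta> (\<lambda>z. 0)"
  shows "\<forall>\<^sub>\<approx>z\<in>D. bq_norm (bq_lambda (F z) (G z)) \<noteq> 0"
proof (cases "D = {}")
  case True
  then show ?thesis by simp
next
  case False
  define M where "M z = F z * F z + bq_scalar (2 * bq0 (G z)) * F z + bq_scalar (bq_norm (G z))" for z
  have "(\<lambda>z. F z * F z + (bq_scalar (bq0 (G z)) + bq_scalar (bq0 (G z))) * F z + bq_scalar (bq_norm (G z))) \<in> stems \<Omega>"
    by (intro stems_closed stems_scalar_coords F G)
  then have M: "M \<in> stems \<Omega>"
    by (simp add: M_def[abs_def])
  have "\<not> stem_eq \<Omega> (\<lambda>z. bq_scalar (bq_norm (M z))) (\<lambda>z. 0)"
  proof
    assume "stem_eq \<Omega> (\<lambda>z. bq_scalar (bq_norm (M z))) (\<lambda>z. 0)"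
    then obtain \<eta> where "\<eta> \<in> stems \<Omega>" "\<not> stem_eq \<Omega> \<eta> (\<lambda>z. 0)"
      "stem_eq \<Omega> (\<lambda>z. M z * \<eta> z) (\<lambda>z. 0)" "stem_eq \<Omega> (\<lambda>z. \<eta> z * M z) (\<lambda>z. 0)"
      using annihilator_if_norm_zero[OF M _ False] by blast
    then show False
      using no_annihilator unfolding M_def by blast
  qed
  then have "\<forall>\<^sub>\<approx>z\<in>D. bq_norm (M z) \<noteq> 0"
    using norm_zero_or_nonzero[OF M] by blast
  with nz show ?thesis
  proof eventually_elim
    case (elim z)
    then show ?case
      using bq_lambda_mult[OF elim(1), of "G z"] bq_norm_mult[of "bq_lambda (F z) (G z)" "F z"]
      by (auto simp: M_def)
  qed
qed

text \<open>
  Let \<open>\<eta>\<close> annihilate the quadratic polynomial. For each basis element \<open>r\<close>, the operator maps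
  \<open>F (\<eta> r) + (\<eta> r) G\<^sup>c\<close> to zero, so this function is itself zero. As \<open>G\<close> is non-central off a sparse
  set, \<open>\<eta>\<close> vanishes there pointwise.
\<close>

lemma lambda_units_if_sylvester_injective:
  assumes F: "F \<in> stems \<Omega>" and G: "G \<in> stems \<Omega>"
    and nR: "stem_class \<Omega> F \<notin> SEM_R \<Omega>" "stem_class \<Omega> G \<notin> SEM_R \<Omega>"
    and nzF: "\<forall>\<^sub>\<approx>z\<in>D. bq_norm (F z) \<noteq> 0" and nzG: "\<forall>\<^sub>\<approx>z\<in>D. bq_norm (G z) \<noteq> 0"
    and inj: "inj_on (sylvester \<Omega> (stem_class \<Omega> F) (stem_class \<Omega> G)) (carrier (SEM \<Omega>))"
  shows "\<forall>\<^sub>\<approx>z\<in>D. bq_norm (bq_lambda (F z) (G z)) \<noteq> 0" "\<forall>\<^sub>\<approx>z\<in>D. bq_norm (bq_lambda (G z) (F z)) \<noteq> 0"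
proof -
  have kernel: "stem_eq \<Omega> X (\<lambda>z. 0)"
    if X: "X \<in> stems \<Omega>" and 0: "stem_eq \<Omega> (\<lambda>z. F z * X z + X z * G z) (\<lambda>z. 0)" for X
  proof -
    have "sylvester \<Omega> (stem_class \<Omega> F) (stem_class \<Omega> G) (stem_class \<Omega> X)
        = sylvester \<Omega> (stem_class \<Omega> F) (stem_class \<Omega> G) (stem_class \<Omega> (\<lambda>z. 0))"
      using stem_class_cong[OF 0] X F G by (simp add: sylvester_stem)
    then have "stem_class \<Omega> X = stem_class \<Omega> (\<lambda>z. 0)"
      using inj X by (auto simp: carrier_SEM dest: inj_onD)
    then show ?thesis
      using X by (simp add: stem_class_eq_iff)
  qed
  have unit_stem: "(\<lambda>z. r) \<in> stems \<Omega>" if "r \<in> {1, bq_i, bq_j, bq_k}" for r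
    using that by auto
  have all_units: "\<forall>\<^sub>\<approx>z\<in>D. \<forall>r\<in>{1, bq_i, bq_j, bq_k}. P r z = 0"
    if "\<And>r. r \<in> {1, bq_i, bq_j, bq_k} \<Longrightarrow> stem_eq \<Omega> (P r) (\<lambda>z. 0)" for P :: "biquat \<Rightarrow> complex \<Rightarrow> biquat"
    using that by (intro eventually_ball_finite ballI) (simp_all add: stem_eq_def)
  show "\<forall>\<^sub>\<approx>z\<in>D. bq_norm (bq_lambda (F z) (G z)) \<noteq> 0"
  proof (rule lambda_norm_nonzero[OF F G nzF])
    fix \<eta> assume \<eta>: "\<eta> \<in> stems \<Omega>"
      and ann: "stem_eq \<Omega> (\<lambda>z. (F z * F z + bq_scalar (2 * bq0 (G z)) * F z + bq_scalar (bq_norm (G z))) * \<eta> z) (\<lambda>z. 0)"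
    have "\<forall>\<^sub>\<approx>z\<in>D. \<forall>r\<in>{1, bq_i, bq_j, bq_k}. F z * (\<eta> z * r) + (\<eta> z * r) * bq_conj (G z) = 0"
    proof (rule all_units, rule kernel)
      fix r assume r: "r \<in> {1, bq_i, bq_j, bq_k}"
      show "(\<lambda>z. F z * (\<eta> z * r) + (\<eta> z * r) * bq_conj (G z)) \<in> stems \<Omega>"
        by (intro stems_closed F G \<eta> unit_stem[OF r])
      show "stem_eq \<Omega> (\<lambda>z. F z * (F z * (\<eta> z * r) + (\<eta> z * r) * bq_conj (G z))
          + (F z * (\<eta> z * r) + (\<eta> z * r) * bq_conj (G z)) * G z) (\<lambda>z. 0)"
        using ann unfolding stem_eq_def bq_cayley_hamilton_left
        by eventually_elim (simp add: mult.assoc[symmetric])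
    qed
    with vector_part_nonzero[OF G nR(2)] show "stem_eq \<Omega> \<eta> (\<lambda>z. 0)"
      unfolding stem_eq_def
    proof eventually_elim
      case (elim z)
      show ?case
        by (rule bq_twisted_linear_right_imp_zero[of "F z" "\<eta> z" "bq_conj (G z)"]) (use elim in auto)
    qed
  qed
  show "\<forall>\<^sub>\<approx>z\<in>D. bq_norm (bq_lambda (G z) (F z)) \<noteq> 0"
  proof (rule lambda_norm_nonzero[OF G F nzG])
    fix \<eta> assume \<eta>: "\<eta> \<in> stems \<Omega>"
      and ann: "stem_eq \<Omega> (\<lambda>z. \<eta> z * (G z * G z + bq_scalar (2 * bq0 (F z)) * G z + bq_scalar (bq_norm (F z)))) (\<lambda>z. 0)"
    have "\<forall>\<^sub>\<approx>z\<in>D. \<forall>r\<in>{1, bq_i, bq_j, bq_k}. bq_conj (F z) * (r * \<eta> z) + (r * \<eta> z) * G z = 0"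
    proof (rule all_units, rule kernel)
      fix r assume r: "r \<in> {1, bq_i, bq_j, bq_k}"
      show "(\<lambda>z. bq_conj (F z) * (r * \<eta> z) + (r * \<eta> z) * G z) \<in> stems \<Omega>"
        by (intro stems_closed F G \<eta> unit_stem[OF r])
      show "stem_eq \<Omega> (\<lambda>z. F z * (bq_conj (F z) * (r * \<eta> z) + (r * \<eta> z) * G z)
          + (bq_conj (F z) * (r * \<eta> z) + (r * \<eta> z) * G z) * G z) (\<lambda>z. 0)"
        using ann unfolding stem_eq_def bq_cayley_hamilton_right
        by eventually_elim (simp add: mult.assoc)
    qed
    with vector_part_nonzero[OF F nR(1)] show "stem_eq \<Omega> \<eta> (\<lambda>z. 0)"
      unfolding stem_eq_def
    proof eventually_elim
      case (elim z)
      show ?case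
        by (rule bq_twisted_linear_left_imp_zero[of "bq_conj (F z)" "\<eta> z" "G z"]) (use elim in auto)
    qed
  qed
qed

lemma sylvester_solution:
  assumes F: "F \<in> stems \<Omega>" and G: "G \<in> stems \<Omega>" and X: "X \<in> stems \<Omega>"
    and nzF: "\<forall>\<^sub>\<approx>z\<in>D. bq_norm (F z) \<noteq> 0" and nzG: "\<forall>\<^sub>\<approx>z\<in>D. bq_norm (G z) \<noteq> 0"
    and L: "\<forall>\<^sub>\<approx>z\<in>D. bq_norm (bq_lambda (F z) (G z)) \<noteq> 0"
    and R: "\<forall>\<^sub>\<approx>z\<in>D. bq_norm (bq_lambda (G z) (F z)) \<noteq> 0"
  defines "f \<equiv> stem_class \<Omega> F" and "g \<equiv> stem_class \<Omega> G" and "x \<equiv> stem_class \<Omega> X"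
    and "b \<equiv> sylvester \<Omega> (stem_class \<Omega> F) (stem_class \<Omega> G) (stem_class \<Omega> X)"
  shows "x = sem_inv \<Omega> (stem_class \<Omega> (\<lambda>z. bq_lambda (F z) (G z))) \<otimes>\<^bsub>SEM \<Omega>\<^esub>
      (b \<oplus>\<^bsub>SEM \<Omega>\<^esub> sem_inv \<Omega> f \<otimes>\<^bsub>SEM \<Omega>\<^esub> b \<otimes>\<^bsub>SEM \<Omega>\<^esub> sem_conj \<Omega> g)" (is ?left)
    "x = (b \<oplus>\<^bsub>SEM \<Omega>\<^esub> sem_conj \<Omega> f \<otimes>\<^bsub>SEM \<Omega>\<^esub> b \<otimes>\<^bsub>SEM \<Omega>\<^esub> sem_inv \<Omega> g) \<otimes>\<^bsub>SEM \<Omega>\<^esub>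
      sem_inv \<Omega> (stem_class \<Omega> (\<lambda>z. bq_lambda (G z) (F z)))" (is ?right)
proof -
  note lam = lambda_stem(1)[OF F G nzF] lambda_stem(1)[OF G F nzG]
  define B where "B z = F z * X z + X z * G z" for z
  have B: "B \<in> stems \<Omega>"
    unfolding B_def[abs_def] by (intro stems_closed F G X)
  have b: "b = stem_class \<Omega> B"
    unfolding b_def B_def[abs_def] using F G X by (rule sylvester_stem)
  have "sem_inv \<Omega> (stem_class \<Omega> (\<lambda>z. bq_lambda (F z) (G z))) \<otimes>\<^bsub>SEM \<Omega>\<^esub>
      (b \<oplus>\<^bsub>SEM \<Omega>\<^esub> sem_inv \<Omega> f \<otimes>\<^bsub>SEM \<Omega>\<^esub> b \<otimes>\<^bsub>SEM \<Omega>\<^esub> sem_conj \<Omega> g)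
    = stem_class \<Omega> (\<lambda>z. bq_inv (bq_lambda (F z) (G z)) * (B z + bq_inv (F z) * B z * bq_conj (G z)))"
    unfolding b f_def g_def sem_inv_stem[OF F nzF] sem_conj_stem[OF G] sem_inv_stem[OF lam(1) L]
    by (simp add: mult_SEM add_SEM stems_closed F G B lam)
  also have "\<dots> = x"
    unfolding x_def
  proof (rule stem_class_cong, unfold stem_eq_def, use nzF L in eventually_elim)
    case (elim z)
    show ?case
      using bq_sylvester_left[OF elim(1), of "X z" "G z"] bq_mult_inv(2)[OF elim(2)]
      by (simp add: B_def mult.assoc[symmetric])
  qed
  finally show ?left ..
  have "(b \<oplus>\<^bsub>SEM \<Omega>\<^esub> sem_conj \<Omega> f \<otimes>\<^bsub>SEM \<Omega>\<^esub> b \<otimes>\<^bsub>SEM \<Omega>\<^esub> sem_inv \<Omega> g) \<otimes>\<^bsub>SEM \<Omega>\<^esub>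
      sem_inv \<Omega> (stem_class \<Omega> (\<lambda>z. bq_lambda (G z) (F z)))
    = stem_class \<Omega> (\<lambda>z. (B z + bq_conj (F z) * B z * bq_inv (G z)) * bq_inv (bq_lambda (G z) (F z)))"
    unfolding b f_def g_def sem_inv_stem[OF G nzG] sem_conj_stem[OF F] sem_inv_stem[OF lam(2) R]
    by (simp add: mult_SEM add_SEM stems_closed F G B lam)
  also have "\<dots> = x"
    unfolding x_def
  proof (rule stem_class_cong, unfold stem_eq_def, use nzG R in eventually_elim)
    case (elim z)
    show ?case
      using bq_sylvester_right[OF elim(1), of "F z" "X z"] bq_mult_inv(1)[OF elim(2)]
      by (simp add: B_def mult.assoc)
  qed
  finally show ?right ..
qed

end

theorem theorem6p6:
  fixes \<Omega> :: "quat set" and f g lamL lamR :: semireg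
  assumes "circular_domain \<Omega>"
    and "f \<in> carrier (SEM \<Omega>) - SEM_R \<Omega>" and "g \<in> carrier (SEM \<Omega>) - SEM_R \<Omega>"
    and "\<not> sem_zero_divisor \<Omega> f" and "\<not> sem_zero_divisor \<Omega> g"
    and "SEM_R_isomorphism \<Omega> (sylvester \<Omega> f g)"
    and "lamL = [(2::nat)] \<cdot>\<^bsub>SEM \<Omega>\<^esub> sem_re \<Omega> g \<oplus>\<^bsub>SEM \<Omega>\<^esub> f \<oplus>\<^bsub>SEM \<Omega>\<^esub> sem_symm \<Omega> g \<otimes>\<^bsub>SEM \<Omega>\<^esub> sem_inv \<Omega> f"
    and "lamR = [(2::nat)] \<cdot>\<^bsub>SEM \<Omega>\<^esub> sem_re \<Omega> f \<oplus>\<^bsub>SEM \<Omega>\<^esub> g \<oplus>\<^bsub>SEM \<Omega>\<^esub> sem_symm \<Omega> f \<otimes>\<^bsub>SEM \<Omega>\<^esub> sem_inv \<Omega> g"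
  shows "lamL \<in> Units (SEM \<Omega>) \<and> lamR \<in> Units (SEM \<Omega>) \<and>
    (\<forall>b\<in>carrier (SEM \<Omega>).
      (\<exists>!x. x \<in> carrier (SEM \<Omega>) \<and> sylvester \<Omega> f g x = b) \<and>
      (\<forall>x\<in>carrier (SEM \<Omega>). sylvester \<Omega> f g x = b \<longrightarrow>
        x = sem_inv \<Omega> lamL \<otimes>\<^bsub>SEM \<Omega>\<^esub>
              (b \<oplus>\<^bsub>SEM \<Omega>\<^esub> sem_inv \<Omega> f \<otimes>\<^bsub>SEM \<Omega>\<^esub> b \<otimes>\<^bsub>SEM \<Omega>\<^esub> sem_conj \<Omega> g) \<and>
        x = (b \<oplus>\<^bsub>SEM \<Omega>\<^esub> sem_conj \<Omega> f \<otimes>\<^bsub>SEM \<Omega>\<^esub> b \<otimes>\<^bsub>SEM \<Omega>\<^esub> sem_inv \<Omega> g) \<otimes>\<^bsub>SEM \<Omega>\<^esub>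
              sem_inv \<Omega> lamR))"
proof -
  interpret circular_connected \<Omega>
    using assms(1) by unfold_locales (simp_all add: circular_domain_def)
  obtain F where F: "F \<in> stems \<Omega>" "f = stem_class \<Omega> F"
    using assms(2) by (auto simp: carrier_SEM)
  obtain G where G: "G \<in> stems \<Omega>" "g = stem_class \<Omega> G"
    using assms(3) by (auto simp: carrier_SEM)
  have nR: "stem_class \<Omega> F \<notin> SEM_R \<Omega>" "stem_class \<Omega> G \<notin> SEM_R \<Omega>"
    using assms(2,3) F G by auto
  have nzF: "\<forall>\<^sub>\<approx>z\<in>D. bq_norm (F z) \<noteq> 0" and nzG: "\<forall>\<^sub>\<approx>z\<in>D. bq_norm (G z) \<noteq> 0"
    using norm_nonzero_if_not_zero_divisor F G nR assms(4,5) by simp_all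
  have bij: "bij_betw (sylvester \<Omega> f g) (carrier (SEM \<Omega>)) (carrier (SEM \<Omega>))"
    using assms(6) by (simp add: SEM_R_isomorphism_def)
  then have "inj_on (sylvester \<Omega> (stem_class \<Omega> F) (stem_class \<Omega> G)) (carrier (SEM \<Omega>))"
    by (simp add: bij_betw_def F G)
  note nz = lambda_units_if_sylvester_injective[OF F(1) G(1) nR nzF nzG this]
  have lamL: "lamL = stem_class \<Omega> (\<lambda>z. bq_lambda (F z) (G z))"
    unfolding assms(7) F(2) G(2) by (rule lambda_stem(2)[OF F(1) G(1) nzF])
  have lamR: "lamR = stem_class \<Omega> (\<lambda>z. bq_lambda (G z) (F z))"
    unfolding assms(8) F(2) G(2) by (rule lambda_stem(2)[OF G(1) F(1) nzG])
  show ?thesis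
  proof (intro conjI ballI impI)
    show "lamL \<in> Units (SEM \<Omega>)"
      unfolding lamL by (rule unit_SEM_stem[OF lambda_stem(1)[OF F(1) G(1) nzF] nz(1)])
    show "lamR \<in> Units (SEM \<Omega>)"
      unfolding lamR by (rule unit_SEM_stem[OF lambda_stem(1)[OF G(1) F(1) nzG] nz(2)])
  next
    fix b assume "b \<in> carrier (SEM \<Omega>)"
    then have "b \<in> sylvester \<Omega> f g ` carrier (SEM \<Omega>)"
      using bij_betw_imp_surj_on[OF bij] by simp
    then obtain x where x: "b = sylvester \<Omega> f g x" "x \<in> carrier (SEM \<Omega>)"
      by (rule imageE)
    show "\<exists>!x. x \<in> carrier (SEM \<Omega>) \<and> sylvester \<Omega> f g x = b"
      using x inj_onD[OF bij_betw_imp_inj_on[OF bij]] by (intro ex1I[of _ x]) simp_all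
  next
    fix b x assume "x \<in> carrier (SEM \<Omega>)" and b: "sylvester \<Omega> f g x = b"
    then obtain X where X: "X \<in> stems \<Omega>" "x = stem_class \<Omega> X"
      by (auto simp: carrier_SEM)
    note sol = sylvester_solution[OF F(1) G(1) X(1) nzF nzG nz, folded lamL lamR F(2) G(2) X(2), unfolded b]
    show "x = sem_inv \<Omega> lamL \<otimes>\<^bsub>SEM \<Omega>\<^esub>
        (b \<oplus>\<^bsub>SEM \<Omega>\<^esub> sem_inv \<Omega> f \<otimes>\<^bsub>SEM \<Omega>\<^esub> b \<otimes>\<^bsub>SEM \<Omega>\<^esub> sem_conj \<Omega> g)"
      by (rule sol(1))
    show "x = (b \<oplus>\<^bsub>SEM \<Omega>\<^esub> sem_conj \<Omega> f \<otimes>\<^bsub>SEM \<Omega>\<^esub> b \<otimes>\<^bsub>SEM \<Omega>\<^esub> sem_inv \<Omega> g) \<otimes>\<^bsub>SEM \<Omega>\<^esub>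
        sem_inv \<Omega> lamR"
      by (rule sol(2))
  qed
qed

end
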